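(* Let $A\in\mathbb{R}_+^{n\times n}$ be irreducible and visualized, let $\mathcal{C}(A)$ be strongly connected, let $\bar c$ be the number of non-critical nodes, and suppose that $\mathcal{C}(A)$ and all its cyclic classes are known. Then Algorithm 1 (the specific algorithm written out in full in the context) computes the coefficients of the attraction system $$\bigoplus_{k\in[i]}x_k\oplus\bigoplus_{t\in K^{(r)}(i)}\alpha^*_{\mu\nu(t)}x_t=\bigoplus_{k\in[j]}x_k\oplus\bigoplus_{t\in K^{(r)}(j)}\alpha^*_{\mu\nu(t)}x_t\qquad\text{for all pairs of cyclic classes with }[i]\to_1[j],$$ where $r\ge T(A)$ is a multiple of $\gamma$ (that is, it computes the numbers $\alpha^*_{\mu\nu(t)}$ for all non-critical $t$ and the sets $K^{(r)}(i)$ for all critical $i$), in no more than $O(\bar c^{3}n)$ operations.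
   Context: Max algebra: on $\mathbb{R}_+=[0,\infty)$ put $a\oplus b=\max(a,b)$, $a\otimes b=ab$, extended to matrices and vectors by $(A\oplus B)_{ij}=\max(a_{ij},b_{ij})$, $(A\otimes B)_{ij}=\max_k a_{ik}b_{kj}$; $A^k$ is the $k$-th max-algebraic power ($A^0=I$), with entries $a^{(k)}_{ij}$. The digraph $\mathcal{D}(A)$ has nodes $1,\dots,n$ and an edge $(i,j)$ of weight $a_{ij}$ iff $a_{ij}\neq 0$; the weight of a path is the product of its edge weights, and the geometric mean of a cycle with $k$ edges is its weight to the power $1/k$. $\lambda(A)$ is the maximum cycle geometric mean. $A$ is definite if $\lambda(A)=1$, and irreducible if for all nodes $i,j$ there is a path in $\mathcal{D}(A)$ from $i$ to $j$. A cycle is critical if its geometric mean equals $\lambda(A)$; the critical graph $\mathcal{C}(A)=(N_c(A),E_c(A))$ consists of all nodes and edges belonging to critical cycles; it is assumed that $N_c(A)=\{1,\dots,c\}$, and $\bar c=n-c$. A matrix $A$ is visualized if it is definite, $a_{ij}\le1$ for all $i,j$ and $a_{ij}=1$ for all $(i,j)\in E_c(A)$. $\mathcal{C}(A)$ is strongly connected here, with cyclicity $\gamma$ (gcd of its cycle lengths). For critical nodes, $i\sim j$ if there is a path in $\mathcal{C}(A)$ from $i$ to $j$ of length $\equiv0\pmod\gamma$; the equivalence classes $[i]$ are the cyclic classes, and $[i]\to_t[j]$ means there is a path in $\mathcal{C}(A)$ from a node of $[i]$ to a node of $[j]$ of length $\equiv t\pmod\gamma$. For a critical node $i$, $[\to_m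 i]$ denotes the cyclic class $[j]$ such that $[j]\to_m[i]$. For a definite $n\times n$ matrix $D$, $D^*=I\oplus D\oplus\dots\oplus D^{n-1}$, with entries $d^*_{ij}$, and $Q(D)$ has entries $q_{ij}=\bigoplus_{k\in N_c(D)}d^*_{ik}d^*_{kj}$. The transient $T(A)$ is an integer such that $A^{t\gamma}=Q(A^\gamma)$ whenever $t\gamma\ge T(A)$, and $A^{r+\gamma}=A^r$ for all $r\ge T(A)$ (it exists for irreducible definite $A$). Core matrix: the index $\mu$ denotes the whole of $\mathcal{C}(A)$, with $N_\mu=\{1,\dots,c\}$, and each non-critical node $t>c$ gives an index $\nu(t)$ with $N_{\nu(t)}=\{t\}$. $A^{Core}=(\alpha_{\rho\sigma})$ is the $(1+\bar c)\times(1+\bar c)$ matrix with $\alpha_{\rho\sigma}=\max\{a_{ij}: i\in N_\rho,j\in N_\sigma\}$; $\alpha^*_{\rho\sigma}$ are the entries of its Kleene star $(A^{Core})^*=I\oplus A^{Core}\oplus\dots\oplus(A^{Core})^{\bar c}$. For $i\le c$, $K^{(r)}(i)=\{t>c:a^{(r)}_{it}=\alpha^*_{\mu\nu(t)}\}$. The displayed system describes the attraction cone $\operatorname{Attr}(A,1)=\{x\in\mathbb{R}_+^n:\ A^s\otimes x=A^{s+1}\otimes x\text{ for some integer } s\}$. Algorithm 1. Input: the visualized matrix $A$, its strongly connected critical graph $\mathcal{C}(A)$, and the cyclic classes of $\mathcal{C}(A)$. Step 1. For each $t>c$ compute $h_{\nu(t)}=\max_{1\le k\le c}a_{kt}$ and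 initialize the Boolean $c$-vector $P_t$ by $P_t(i)=1$ if $[\to_1 i]\cap\arg\max_{1\le k\le c}a_{kt}\neq\emptyset$, and $P_t(i)=0$ otherwise ($i\le c$). Step 2. Let $B=(b_{\nu(s)\nu(t)})$, $b_{\nu(s)\nu(t)}=a_{st}$ for $s,t>c$, be the non-critical principal submatrix of $A$. Compute its Kleene star $B^*=I\oplus B\oplus\dots\oplus B^{\bar c-1}$, with entries $b^*_{\nu(s)\nu(t)}$, and for all $s,t>c$ the set $U_{st}$ of all exponents $m\in\{0,\dots,\bar c-1\}$ at which the maximum defining $b^*_{\nu(s)\nu(t)}$ is attained (i.e. the lengths of the non-critical paths of maximal weight from $s$ to $t$). Step 3. Compute the vector $h^T\otimes B^*$ (its entries are the coefficients $\alpha^*_{\mu\nu(t)}$) and, for each $t>c$, the set $W_t=\arg\max_{s>c}h_{\nu(s)}b^*_{\nu(s)\nu(t)}$. For $s\in W_t$ and $m\in U_{st}$ form the shifted Boolean vector $P_s^{\to m}$, where $P_s^{\to m}(i)=1$ if and only if $P_s(j)=1$ for $j$ with $[j]\to_m[i]$ (equivalently, $[\to_{m+1}i]\cap\arg\max_{1\le k\le c}a_{ks}\ne\emptyset$). Compute the Boolean vector $G_t=\bigvee_{s\in W_t}\bigvee_{m\in U_{st}}P_s^{\to m}$. Step 4. For each $i\le c$ output $K^{(r)}(i)=\{t>c: G_t(i)=1\}$. *)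

theory Defs
  imports
    Complex_Main
    "HOL-Library.State_Monad"
    "HOL-Number_Theory.Cong"
    "Graph_Theory.Graph_Theory"
begin

section \<open>Max algebra\<close>

text \<open>
  Matrices are functions on indices; the finite index set \<open>S\<close> is passed explicitly, since principal
  submatrices and the core matrix are needed besides \<open>n \<times> n\<close> matrices. The index set of an \<open>n \<times> n\<close>
  matrix is \<open>{..<n}\<close>, i.e. nodes are numbered from 0. All entries are meant to be nonnegative, so that
  the \<open>0\<close> in the next definition only fixes the value of an empty max-algebraic sum.
\<close>

definition msum :: "('a \<Rightarrow> real) \<Rightarrow> 'a set \<Rightarrow> real" where
  "msum f S = Max (insert 0 (f ` S))"

definition mmul :: "'i set \<Rightarrow> ('i \<Rightarrow> 'i \<Rightarrow> real) \<Rightarrow> ('i \<Rightarrow> 'i \<Rightarrow> real) \<Rightarrow> 'i \<Rightarrow> 'i \<Rightarrow> real" where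
  "mmul S A B = (\<lambda>i j. msum (\<lambda>k. A i k * B k j) S)"

primrec mpow :: "'i set \<Rightarrow> ('i \<Rightarrow> 'i \<Rightarrow> real) \<Rightarrow> nat \<Rightarrow> 'i \<Rightarrow> 'i \<Rightarrow> real" where
  "mpow S A 0 = (\<lambda>i j. if i = j then 1 else 0)"
| "mpow S A (Suc k) = mmul S (mpow S A k) A"

definition kleene_star :: "'i set \<Rightarrow> ('i \<Rightarrow> 'i \<Rightarrow> real) \<Rightarrow> 'i \<Rightarrow> 'i \<Rightarrow> real" where
  "kleene_star S A = (\<lambda>i j. msum (\<lambda>k. mpow S A k i j) {..<card S})"

definition nonneg_matrix :: "nat \<Rightarrow> (nat \<Rightarrow> nat \<Rightarrow> real) \<Rightarrow> bool" where
  "nonneg_matrix n A \<longleftrightarrow> (\<forall>i<n. \<forall>j<n. 0 \<le> A i j)"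


section \<open>Digraphs, critical graph\<close>

definition digraph_of :: "nat \<Rightarrow> (nat \<Rightarrow> nat \<Rightarrow> real) \<Rightarrow> nat pair_pre_digraph" where
  "digraph_of n A = \<lparr>pverts = {..<n}, parcs = {(i, j). i < n \<and> j < n \<and> A i j \<noteq> 0}\<rparr>"

definition cycles :: "nat pair_pre_digraph \<Rightarrow> (nat \<times> nat) list set" where
  "cycles G = {p. pre_digraph.cycle (with_proj G) p}"

definition path_weight :: "(nat \<Rightarrow> nat \<Rightarrow> real) \<Rightarrow> (nat \<times> nat) list \<Rightarrow> real" where
  "path_weight A p = prod_list (map (\<lambda>(i, j). A i j) p)"

definition geometric_mean :: "(nat \<Rightarrow> nat \<Rightarrow> real) \<Rightarrow> (nat \<times> nat) list \<Rightarrow> real" where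
  "geometric_mean A p = root (length p) (path_weight A p)"

definition max_cycle_mean :: "nat \<Rightarrow> (nat \<Rightarrow> nat \<Rightarrow> real) \<Rightarrow> real" where
  "max_cycle_mean n A = msum (geometric_mean A) (cycles (digraph_of n A))"

definition definite :: "nat \<Rightarrow> (nat \<Rightarrow> nat \<Rightarrow> real) \<Rightarrow> bool" where
  "definite n A \<longleftrightarrow> max_cycle_mean n A = 1"

definition irreducible_matrix :: "nat \<Rightarrow> (nat \<Rightarrow> nat \<Rightarrow> real) \<Rightarrow> bool" where
  "irreducible_matrix n A \<longleftrightarrow> strongly_connected (with_proj (digraph_of n A))"

definition critical_cycles :: "nat \<Rightarrow> (nat \<Rightarrow> nat \<Rightarrow> real) \<Rightarrow> (nat \<times> nat) list set" where
  "critical_cycles n A = {p \<in> cycles (digraph_of n A). geometric_mean A p = max_cycle_mean n A}"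

definition critical_graph :: "nat \<Rightarrow> (nat \<Rightarrow> nat \<Rightarrow> real) \<Rightarrow> nat pair_pre_digraph" where
  "critical_graph n A =
     \<lparr>pverts = (\<Union>p \<in> critical_cycles n A. fst ` set p \<union> snd ` set p),
      parcs = (\<Union>p \<in> critical_cycles n A. set p)\<rparr>"

definition visualized :: "nat \<Rightarrow> (nat \<Rightarrow> nat \<Rightarrow> real) \<Rightarrow> bool" where
  "visualized n A \<longleftrightarrow> definite n A \<and> (\<forall>i<n. \<forall>j<n. A i j \<le> 1) \<and>
     (\<forall>(i, j) \<in> parcs (critical_graph n A). A i j = 1)"


section \<open>Cyclic classes\<close>

definition cyclicity :: "nat pair_pre_digraph \<Rightarrow> nat" where
  "cyclicity G = Gcd (length ` cycles G)"

definition path_mod :: "nat pair_pre_digraph \<Rightarrow> nat \<Rightarrow> nat \<Rightarrow> nat \<Rightarrow> bool" where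
  "path_mod G m i j \<longleftrightarrow>
     (\<exists>p. pre_digraph.awalk (with_proj G) i p j \<and> [length p = m] (mod cyclicity G))"

definition cyclic_class :: "nat pair_pre_digraph \<Rightarrow> nat \<Rightarrow> nat set" where
  "cyclic_class G i = {j \<in> pverts G. path_mod G 0 i j}"

definition class_arrow :: "nat pair_pre_digraph \<Rightarrow> nat \<Rightarrow> nat set \<Rightarrow> nat set \<Rightarrow> bool" where
  "class_arrow G m X Y \<longleftrightarrow> (\<exists>i\<in>X. \<exists>j\<in>Y. path_mod G m i j)"


section \<open>Transient, core matrix, attraction system\<close>

definition Q_matrix :: "nat \<Rightarrow> (nat \<Rightarrow> nat \<Rightarrow> real) \<Rightarrow> nat \<Rightarrow> nat \<Rightarrow> real" where
  "Q_matrix n D = (\<lambda>i j. msum (\<lambda>k. kleene_star {..<n} D i k * kleene_star {..<n} D k j)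
     (pverts (critical_graph n D)))"

definition is_transient :: "nat \<Rightarrow> (nat \<Rightarrow> nat \<Rightarrow> real) \<Rightarrow> nat \<Rightarrow> bool" where
  "is_transient n A T \<longleftrightarrow>
     (let \<gamma> = cyclicity (critical_graph n A) in
      (\<forall>t. t * \<gamma> \<ge> T \<longrightarrow> (\<forall>i<n. \<forall>j<n.
         mpow {..<n} A (t * \<gamma>) i j = Q_matrix n (mpow {..<n} A \<gamma>) i j)) \<and>
      (\<forall>r\<ge>T. \<forall>i<n. \<forall>j<n. mpow {..<n} A (r + \<gamma>) i j = mpow {..<n} A r i j))"

datatype core_index = Mu | Nu nat

text \<open>From here on \<open>c\<close> is the number of critical nodes, which are assumed to be \<open>0, \<dots>, c - 1\<close>.\<close>

primrec block :: "nat \<Rightarrow> core_index \<Rightarrow> nat set" where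
  "block c Mu = {..<c}"
| "block c (Nu t) = {t}"

definition core_indices :: "nat \<Rightarrow> nat \<Rightarrow> core_index set" where
  "core_indices n c = insert Mu (Nu ` {c..<n})"

definition core_matrix :: "nat \<Rightarrow> (nat \<Rightarrow> nat \<Rightarrow> real) \<Rightarrow> core_index \<Rightarrow> core_index \<Rightarrow> real" where
  "core_matrix c A = (\<lambda>\<rho> \<sigma>. msum (\<lambda>(i, j). A i j) (block c \<rho> \<times> block c \<sigma>))"

definition core_star :: "nat \<Rightarrow> nat \<Rightarrow> (nat \<Rightarrow> nat \<Rightarrow> real) \<Rightarrow> core_index \<Rightarrow> core_index \<Rightarrow> real" where
  "core_star n c A = kleene_star (core_indices n c) (core_matrix c A)"

definition K_set :: "nat \<Rightarrow> nat \<Rightarrow> (nat \<Rightarrow> nat \<Rightarrow> real) \<Rightarrow> nat \<Rightarrow> nat \<Rightarrow> nat set" where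
  "K_set n c A r i = {t \<in> {c..<n}. mpow {..<n} A r i t = core_star n c A Mu (Nu t)}"

text \<open>
  The attraction system in the unknown vector \<open>x\<close>, for arbitrary coefficients \<open>\<alpha>\<close> and index sets \<open>K\<close>.
\<close>

definition attraction_system ::
  "nat pair_pre_digraph \<Rightarrow> (nat \<Rightarrow> real) \<Rightarrow> (nat \<Rightarrow> nat set) \<Rightarrow> (nat \<Rightarrow> real) \<Rightarrow> bool" where
  "attraction_system G \<alpha> K x \<longleftrightarrow>
     (\<forall>i \<in> pverts G. \<forall>j \<in> pverts G. class_arrow G 1 (cyclic_class G i) (cyclic_class G j) \<longrightarrow>
        max (msum x (cyclic_class G i)) (msum (\<lambda>t. \<alpha> t * x t) (K i)) =
        max (msum x (cyclic_class G j)) (msum (\<lambda>t. \<alpha> t * x t) (K j)))"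


section \<open>Cost model\<close>

text \<open>
  A computation is a state transformer whose only state is the number of operations performed so
  far. One operation is charged for each evaluation of a basic function (\<open>op1\<close>, \<open>op2\<close>; they are used
  only with \<open>max\<close>, \<open>*\<close>, \<open>=\<close>, \<open>\<or>\<close>, the decrement of an index, and \<open>hd\<close> and \<open>#\<close> on lists), for each
  access to an array cell (\<open>rd\<close>, \<open>wr\<close>), and for each iteration of a loop. Arithmetic and comparison of
  reals are exact. Arrays are functions on their indices. A new array (\<open>undefined\<close>) has unspecified
  contents, so its cells have to be written before they are read. Free of charge are constants, branching on an
  already computed Boolean, and the bounds of loops (\<open>n\<close>, \<open>c\<close> and \<open>n - c\<close>).
\<close>

type_synonym 'a counted = "(nat, 'a) state"

definition op1 :: "('a \<Rightarrow> 'b) \<Rightarrow> 'a \<Rightarrow> 'b counted" where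
  "op1 f x = do { State_Monad.update Suc; State_Monad.return (f x) }"

definition op2 :: "('a \<Rightarrow> 'b \<Rightarrow> 'c) \<Rightarrow> 'a \<Rightarrow> 'b \<Rightarrow> 'c counted" where
  "op2 f x y = do { State_Monad.update Suc; State_Monad.return (f x y) }"

definition rd :: "('i \<Rightarrow> 'a) \<Rightarrow> 'i \<Rightarrow> 'a counted" where
  "rd a i = do { State_Monad.update Suc; State_Monad.return (a i) }"

definition wr :: "('i \<Rightarrow> 'a) \<Rightarrow> 'i \<Rightarrow> 'a \<Rightarrow> ('i \<Rightarrow> 'a) counted" where
  "wr a i v = do { State_Monad.update Suc; State_Monad.return (a(i := v)) }"

primrec for_each :: "nat list \<Rightarrow> 's \<Rightarrow> (nat \<Rightarrow> 's \<Rightarrow> 's counted) \<Rightarrow> 's counted" where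
  "for_each [] s f = State_Monad.return s"
| "for_each (k # ks) s f = do { State_Monad.update Suc; s' \<leftarrow> f k s; for_each ks s' f }"


section \<open>The algorithm\<close>

text \<open>
  Input: the matrix \<open>A\<close>; the critical graph, as lists \<open>N i\<close> of the starting nodes of the critical edges
  ending in \<open>i\<close>; the cyclic classes, as labels \<open>cl i\<close> that are equal exactly for nodes of the same class.
  The numbering of the classes is arbitrary.
\<close>

definition represents_critical_graph ::
  "nat pair_pre_digraph \<Rightarrow> (nat \<Rightarrow> nat list) \<Rightarrow> bool" where
  "represents_critical_graph G N \<longleftrightarrow> (\<forall>i \<in> pverts G. set (N i) = {j. (j, i) \<in> parcs G})"

definition represents_cyclic_classes :: "nat pair_pre_digraph \<Rightarrow> (nat \<Rightarrow> nat) \<Rightarrow> bool" where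
  "represents_cyclic_classes G cl \<longleftrightarrow>
     (\<forall>i \<in> pverts G. cl i < card (pverts G)) \<and>
     (\<forall>i \<in> pverts G. \<forall>j \<in> pverts G. cl i = cl j \<longleftrightarrow> cyclic_class G i = cyclic_class G j)"

text \<open>
  Step 1 computes \<open>h\<close> and \<open>P\<close> (with \<open>P (t, i)\<close> for the paper's \<open>P\<^sub>t(i)\<close>). For each \<open>t\<close>, the array \<open>F\<close>
  marks the classes that meet the arg max; the class \<open>[\<rightarrow>\<^sub>1 i]\<close> is the class of any starting node of a
  critical edge ending in \<open>i\<close>.
\<close>

definition step1 :: "nat \<Rightarrow> nat \<Rightarrow> (nat \<Rightarrow> nat \<Rightarrow> real) \<Rightarrow> (nat \<Rightarrow> nat list) \<Rightarrow> (nat \<Rightarrow> nat)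
    \<Rightarrow> ((nat \<Rightarrow> real) \<times> (nat \<times> nat \<Rightarrow> bool)) counted" where
  "step1 n c A N cl =
     for_each [c..<n] (undefined, undefined) (\<lambda>t (h, P). do {
       v \<leftarrow> for_each [0..<c] 0 (\<lambda>k v. do { a \<leftarrow> rd (case_prod A) (k, t); op2 max v a });
       h \<leftarrow> wr h t v;
       F \<leftarrow> for_each [0..<c] undefined (\<lambda>q F. wr F q False);
       F \<leftarrow> for_each [0..<c] F (\<lambda>k F. do {
         a \<leftarrow> rd (case_prod A) (k, t);
         e \<leftarrow> op2 (=) a v;
         if e then do { q \<leftarrow> rd cl k; wr F q True } else State_Monad.return F });
       P \<leftarrow> for_each [0..<c] P (\<lambda>i P. do {
         js \<leftarrow> rd N i;
         j \<leftarrow> op1 hd js;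
         q \<leftarrow> rd cl j;
         b \<leftarrow> rd F q;
         wr P (t, i) b });
       State_Monad.return (h, P) })"

text \<open>
  Step 2 computes the powers \<open>B\<^sup>m\<close> for \<open>m < n - c\<close> (entries \<open>pw (m, s, t)\<close>), the entries \<open>bs (s, t)\<close> of
  \<open>B\<^sup>*\<close>, and the sets \<open>U\<^sub>s\<^sub>t\<close> as the Boolean array \<open>U (m, s, t)\<close>. The matrix \<open>B\<close> is read directly from \<open>A\<close>.
\<close>

definition nc_powers :: "nat \<Rightarrow> nat \<Rightarrow> (nat \<Rightarrow> nat \<Rightarrow> real) \<Rightarrow> (nat \<times> nat \<times> nat \<Rightarrow> real) counted" where
  "nc_powers n c A =
     for_each [0..<n - c] undefined (\<lambda>m pw. for_each [c..<n] pw (\<lambda>s pw. for_each [c..<n] pw (\<lambda>t pw. do {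
       z \<leftarrow> op2 (=) m 0;
       if z then do {
         e \<leftarrow> op2 (=) s t;
         wr pw (m, s, t) (if e then 1 else 0) }
       else do {
         m' \<leftarrow> op2 (-) m 1;
         v \<leftarrow> for_each [c..<n] 0 (\<lambda>k v. do {
           x \<leftarrow> rd pw (m', s, k);
           y \<leftarrow> rd (case_prod A) (k, t);
           w \<leftarrow> op2 (*) x y;
           op2 max v w });
         wr pw (m, s, t) v } })))"

definition step2 :: "nat \<Rightarrow> nat \<Rightarrow> (nat \<Rightarrow> nat \<Rightarrow> real)
    \<Rightarrow> ((nat \<times> nat \<Rightarrow> real) \<times> (nat \<times> nat \<times> nat \<Rightarrow> bool)) counted" where
  "step2 n c A = do {
     pw \<leftarrow> nc_powers n c A;
     for_each [c..<n] (undefined, undefined) (\<lambda>s r. for_each [c..<n] r (\<lambda>t (bs, U). do {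
       v \<leftarrow> for_each [0..<n - c] 0 (\<lambda>m v. do { x \<leftarrow> rd pw (m, s, t); op2 max v x });
       bs \<leftarrow> wr bs (s, t) v;
       U \<leftarrow> for_each [0..<n - c] U (\<lambda>m U. do {
         x \<leftarrow> rd pw (m, s, t);
         e \<leftarrow> op2 (=) x v;
         wr U (m, s, t) e });
       State_Monad.return (bs, U) })) }"

text \<open>
  Step 3: \<open>\<alpha>\<close> is \<open>h\<^sup>T \<otimes> B\<^sup>*\<close>, and \<open>W (s, t)\<close> tells whether \<open>s \<in> W\<^sub>t\<close>. To shift Boolean vectors, critical
  edges are followed backwards: from the node \<open>back (m, i)\<close> some path of length \<open>m\<close> in the critical
  graph leads to \<open>i\<close>, hence \<open>[back (m, i)] \<rightarrow>\<^sub>m [i]\<close>, and the entry of \<open>P\<^sub>s\<close> at \<open>back (m, i)\<close> is the entry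
  at \<open>i\<close> of the vector \<open>P\<^sub>s\<close> shifted by \<open>m\<close>.
\<close>

definition h_times_star :: "nat \<Rightarrow> nat \<Rightarrow> (nat \<Rightarrow> real) \<Rightarrow> (nat \<times> nat \<Rightarrow> real)
    \<Rightarrow> ((nat \<Rightarrow> real) \<times> (nat \<times> nat \<Rightarrow> bool)) counted" where
  "h_times_star n c h bs =
     for_each [c..<n] (undefined, undefined) (\<lambda>t (\<alpha>, W). do {
       v \<leftarrow> for_each [c..<n] 0 (\<lambda>s v. do {
         x \<leftarrow> rd h s; y \<leftarrow> rd bs (s, t); w \<leftarrow> op2 (*) x y; op2 max v w });
       \<alpha> \<leftarrow> wr \<alpha> t v;
       W \<leftarrow> for_each [c..<n] W (\<lambda>s W. do {
         x \<leftarrow> rd h s; y \<leftarrow> rd bs (s, t); w \<leftarrow> op2 (*) x y;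
         e \<leftarrow> op2 (=) w v;
         wr W (s, t) e });
       State_Monad.return (\<alpha>, W) })"

definition back_table :: "nat \<Rightarrow> nat \<Rightarrow> (nat \<Rightarrow> nat list) \<Rightarrow> (nat \<times> nat \<Rightarrow> nat) counted" where
  "back_table n c N =
     for_each [0..<n - c] undefined (\<lambda>m back. for_each [0..<c] back (\<lambda>i back. do {
       z \<leftarrow> op2 (=) m 0;
       if z then wr back (m, i) i
       else do {
         m' \<leftarrow> op2 (-) m 1;
         j \<leftarrow> rd back (m', i);
         ks \<leftarrow> rd N j;
         k \<leftarrow> op1 hd ks;
         wr back (m, i) k } }))"

definition step3 :: "nat \<Rightarrow> nat \<Rightarrow> (nat \<Rightarrow> nat list) \<Rightarrow> (nat \<Rightarrow> real) \<Rightarrow> (nat \<times> nat \<Rightarrow> bool)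
    \<Rightarrow> (nat \<times> nat \<Rightarrow> real) \<Rightarrow> (nat \<times> nat \<times> nat \<Rightarrow> bool)
    \<Rightarrow> ((nat \<Rightarrow> real) \<times> (nat \<times> nat \<Rightarrow> bool)) counted" where
  "step3 n c N h P bs U = do {
     (\<alpha>, W) \<leftarrow> h_times_star n c h bs;
     back \<leftarrow> back_table n c N;
     G \<leftarrow> for_each [c..<n] undefined (\<lambda>t G. do {
       G \<leftarrow> for_each [0..<c] G (\<lambda>i G. wr G (t, i) False);
       for_each [c..<n] G (\<lambda>s G. do {
         w \<leftarrow> rd W (s, t);
         if w then for_each [0..<n - c] G (\<lambda>m G. do {
           u \<leftarrow> rd U (m, s, t);
           if u then for_each [0..<c] G (\<lambda>i G. do {
             j \<leftarrow> rd back (m, i);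
             p \<leftarrow> rd P (s, j);
             g \<leftarrow> rd G (t, i);
             g' \<leftarrow> op2 (\<or>) g p;
             wr G (t, i) g' })
           else State_Monad.return G })
         else State_Monad.return G }) });
     State_Monad.return (\<alpha>, G) }"

text \<open>
  Step 4 outputs each set as a list; the lists are initially empty. The loop over \<open>t\<close> is the outer one,
  so that nothing is charged if all nodes are critical, in accordance with the bound \<open>O(0)\<close>.
\<close>

definition step4 :: "nat \<Rightarrow> nat \<Rightarrow> (nat \<times> nat \<Rightarrow> bool) \<Rightarrow> (nat \<Rightarrow> nat list) counted" where
  "step4 n c G =
     for_each [c..<n] (\<lambda>_. []) (\<lambda>t K. for_each [0..<c] K (\<lambda>i K. do {
       g \<leftarrow> rd G (t, i);
       if g then do { ks \<leftarrow> rd K i; ks' \<leftarrow> op2 (#) t ks; wr K i ks' }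
       else State_Monad.return K }))"

definition algorithm1 :: "nat \<Rightarrow> nat \<Rightarrow> (nat \<Rightarrow> nat \<Rightarrow> real) \<Rightarrow> (nat \<Rightarrow> nat list) \<Rightarrow> (nat \<Rightarrow> nat)
    \<Rightarrow> ((nat \<Rightarrow> real) \<times> (nat \<Rightarrow> nat list)) counted" where
  "algorithm1 n c A N cl = do {
     (h, P) \<leftarrow> step1 n c A N cl;
     (bs, U) \<leftarrow> step2 n c A;
     (\<alpha>, G) \<leftarrow> step3 n c N h P bs U;
     K \<leftarrow> step4 n c G;
     State_Monad.return (\<alpha>, K) }"

end

theory Submission
  imports Defs
begin

text \<open>
  Splitting a walk from a critical node \<open>i\<close> to a non-critical node \<open>t\<close> at its last critical node
  bounds the entry of \<open>A\<^sup>r\<close> at \<open>i, t\<close> by \<open>max\<^sub>s h\<^sub>s b\<^sup>*\<^sub>s\<^sub>t\<close>, and the same splitting in the core matrix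
  identifies this bound with \<open>\<alpha>\<^sup>*\<close>. If equality holds and the value is positive, the critical
  part of an optimal walk has weight 1; closed up through the strongly connected critical graph, it
  becomes a closed walk of weight 1, all of whose edges are critical, so its length modulo \<open>\<gamma>\<close> is
  determined by the cyclic classes of its ends. The non-critical part contains no cycle, since such a
  cycle would have weight less than 1 and cutting it out would increase the weight; hence its length
  is less than \<open>n - c\<close>. Conversely, a walk of the required length modulo \<open>\<gamma>\<close> is prolonged by critical
  closed walks at \<open>i\<close>, and periodicity of the powers from \<open>T\<close> on gives the value at \<open>r\<close>.
\<close>

section \<open>Max-algebraic powers\<close>

lemma msum_nonneg: "finite S \<Longrightarrow> 0 \<le> msum f S"
  unfolding msum_def by (rule Max_ge) auto

lemma msum_ge: "finite S \<Longrightarrow> k \<in> S \<Longrightarrow> f k \<le> msum f S"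
  unfolding msum_def by (rule Max_ge) auto

lemma msum_le_iff: "finite S \<Longrightarrow> 0 \<le> b \<Longrightarrow> msum f S \<le> b \<longleftrightarrow> (\<forall>k\<in>S. f k \<le> b)"
  unfolding msum_def by (subst Max_le_iff) auto

text \<open>Positivity rules out the \<open>0\<close> that \<open>msum\<close> inserts, so the
  maximum comes from a genuine index. This is why many arguments below split on whether an entry is
  positive.\<close>

lemma msum_attained:
  assumes "finite S" "0 < msum f S"
  obtains k where "k \<in> S" "msum f S = f k"
proof -
  have "msum f S \<in> insert 0 (f ` S)"
    unfolding msum_def using assms(1) by (intro Max_in) auto
  then show thesis using assms(2) that by auto
qed

lemma msum_cong: "(\<And>k. k \<in> S \<Longrightarrow> f k = g k) \<Longrightarrow> msum f S = msum g S"
  unfolding msum_def by (simp cong: image_cong)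

lemma msum_image: "msum f (g ` S) = msum (\<lambda>k. f (g k)) S"
  unfolding msum_def by (simp add: image_image)

lemma msum_insert: "finite S \<Longrightarrow> msum f (insert k S) = max (msum f S) (f k)"
  unfolding msum_def by (simp add: insert_commute[of 0] max.commute)

lemma msum_empty [simp]: "msum f {} = 0"
  unfolding msum_def by simp

lemma mpow_nonneg: "finite S \<Longrightarrow> 0 \<le> mpow S A k i j"
  by (cases k) (auto simp: mmul_def msum_nonneg)

lemma mpow_Suc_ge:
  "finite S \<Longrightarrow> k \<in> S \<Longrightarrow> mpow S A m i k * A k j \<le> mpow S A (Suc m) i j"
  unfolding mpow.simps mmul_def by (rule msum_ge)

lemma mpow_Suc_attained:
  assumes "finite S" "0 < mpow S A (Suc m) i j"
  obtains k where "k \<in> S" "mpow S A (Suc m) i j = mpow S A m i k * A k j"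
    "0 < mpow S A m i k" "0 < A k j"
proof -
  obtain k where k: "k \<in> S" "mpow S A (Suc m) i j = mpow S A m i k * A k j"
    using msum_attained[OF assms(1), of "\<lambda>k. mpow S A m i k * A k j"] assms(2)
    by (auto simp: mmul_def)
  moreover have "0 \<le> mpow S A m i k" by (rule mpow_nonneg[OF assms(1)])
  ultimately show thesis using assms(2) that by (auto simp: zero_less_mult_iff)
qed

lemma mpow_le_1:
  assumes "finite S" "\<And>i j. i \<in> S \<Longrightarrow> j \<in> S \<Longrightarrow> 0 \<le> A i j \<and> A i j \<le> 1" "j \<in> S"
  shows "mpow S A m i j \<le> 1"
  using assms(3)
proof (induction m arbitrary: j)
  case (Suc m)
  show ?case unfolding mpow.simps mmul_def
    using Suc assms(2) by (auto simp: msum_le_iff[OF assms(1)] mpow_nonneg[OF assms(1)] intro!: mult_le_one)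
qed simp

text \<open>Walks are concatenated at \<open>k\<close>; this is the inequality half of the law that
  powers multiply by adding exponents.\<close>

lemma mpow_mult_le:
  assumes "finite S" "\<And>i j. i \<in> S \<Longrightarrow> j \<in> S \<Longrightarrow> 0 \<le> A i j" "k \<in> S" "j \<in> S"
  shows "mpow S A a i k * mpow S A b k j \<le> mpow S A (a + b) i j"
  using assms(4)
proof (induction b arbitrary: j)
  case 0
  then show ?case using mpow_nonneg[OF assms(1)] by auto
next
  case (Suc b)
  show ?case
  proof (cases "0 < mpow S A (Suc b) k j")
    case True
    then obtain l where l: "l \<in> S" "mpow S A (Suc b) k j = mpow S A b k l * A l j" "0 < A l j"
      using mpow_Suc_attained[OF assms(1)] by metis
    have "mpow S A a i k * mpow S A b k l * A l j \<le> mpow S A (a + b) i l * A l j"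
      using Suc.IH l by (intro mult_right_mono) auto
    also have "\<dots> \<le> mpow S A (Suc (a + b)) i j"
      by (rule mpow_Suc_ge[OF assms(1) l(1)])
    finally show ?thesis using l(2) by (simp add: mult.assoc)
  next
    case False
    then have "mpow S A (Suc b) k j = 0"
      using mpow_nonneg[OF assms(1), of A "Suc b" k j] by linarith
    then show ?thesis using mpow_nonneg[OF assms(1), of A "a + Suc b" i j] by (metis mult_zero_right)
  qed
qed

lemma mpow_one_ge:
  assumes "finite S" "i \<in> S"
  shows "A i j \<le> mpow S A 1 i j"
  using mpow_Suc_ge[OF assms, of A 0 i j] by simp

text \<open>A walk inside \<open>S\<close> is also a walk inside \<open>S'\<close>. This embeds the
  non-critical submatrix into \<open>A\<close> and the singleton blocks into the core
  matrix.\<close>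

lemma mpow_mono_set:
  assumes "finite S'" "S \<subseteq> S'" "\<And>i j. i \<in> S' \<Longrightarrow> j \<in> S' \<Longrightarrow> 0 \<le> A i j" "i \<in> S" "j \<in> S"
  shows "mpow S A m i j \<le> mpow S' A m i j"
  using assms(5)
proof (induction m arbitrary: j)
  case (Suc m)
  have S: "finite S" using assms(1,2) by (rule rev_finite_subset)
  show ?case
  proof (cases "0 < mpow S A (Suc m) i j")
    case True
    then obtain k where k: "k \<in> S" "mpow S A (Suc m) i j = mpow S A m i k * A k j" "0 < A k j"
      using mpow_Suc_attained[OF S] by metis
    have "mpow S A m i k * A k j \<le> mpow S' A m i k * A k j"
      using Suc.IH k by (intro mult_right_mono) auto
    also have "\<dots> \<le> mpow S' A (Suc m) i j"
      using assms(1,2) k(1) by (intro mpow_Suc_ge) auto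
    finally show ?thesis using k(2) by simp
  next
    case False
    then show ?thesis using mpow_nonneg[OF assms(1), of A "Suc m" i j] by linarith
  qed
qed simp

text \<open>Here \<open>k\<close> is the last node of an optimal walk that lies in \<open>C\<close>.\<close>

lemma mpow_last_visit:
  assumes "finite S" "C \<subseteq> S" "\<And>i j. i \<in> S \<Longrightarrow> j \<in> S \<Longrightarrow> 0 \<le> A i j"
    and "i \<in> C" "j \<in> S - C" "0 < mpow S A r i j"
  shows "\<exists>k\<in>C. \<exists>s\<in>S - C. \<exists>l m. r = l + 1 + m \<and>
    mpow S A r i j \<le> mpow S A l i k * A k s * mpow (S - C) A m s j"
  using assms(5,6)
proof (induction r arbitrary: j)
  case 0
  then show ?case using assms(4) by (auto split: if_splits)
next
  case (Suc r)
  from mpow_Suc_attained[OF assms(1) Suc.prems(2)]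
  obtain u where u: "u \<in> S" "mpow S A (Suc r) i j = mpow S A r i u * A u j"
    "0 < mpow S A r i u" "0 < A u j" .
  show ?case
  proof (cases "u \<in> C")
    case True
    \<comment> \<open>The last edge leaves \<open>C\<close>, so the tail is the empty walk at
      \<open>j\<close>, of weight 1.\<close>
    then show ?thesis using u(2) Suc.prems(1)
      by (intro bexI[of _ u] bexI[of _ j] exI[of _ r] exI[of _ 0]) auto
  next
    case False
    with Suc.IH[of u] u obtain k s l m where
      ks: "k \<in> C" "s \<in> S - C" "r = l + 1 + m"
      and le: "mpow S A r i u \<le> mpow S A l i k * A k s * mpow (S - C) A m s u"
      by blast
    have "mpow S A (Suc r) i j \<le> mpow S A l i k * A k s * (mpow (S - C) A m s u * A u j)"
      unfolding u(2) mult.assoc[symmetric]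
      using le u(4) by (intro mult_right_mono) (auto simp: mult.assoc)
    also have "\<dots> \<le> mpow S A l i k * A k s * mpow (S - C) A (Suc m) s j"
      using ks u(1) False assms(1-3) mpow_nonneg[OF assms(1)]
      by (intro mult_left_mono mpow_Suc_ge mult_nonneg_nonneg) auto
    finally show ?thesis using ks
      by (intro bexI[of _ k] bexI[of _ s] exI[of _ l] exI[of _ "Suc m"]) auto
  qed
qed

section \<open>Weights of walks and matrix powers\<close>

lemma pcas_append: "pcas u (p @ q) v \<longleftrightarrow> (\<exists>w. pcas u p w \<and> pcas w q v)"
  by (induction p arbitrary: u) auto

lemma path_weight_simps [simp]:
  "path_weight A [] = 1"
  "path_weight A (e # p) = A (fst e) (snd e) * path_weight A p"
  "path_weight A (p @ q) = path_weight A p * path_weight A q"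
  unfolding path_weight_def by (auto simp: case_prod_beta)

lemma path_weight_le_mpow:
  assumes "finite S" "\<And>i j. i \<in> S \<Longrightarrow> j \<in> S \<Longrightarrow> 0 \<le> A i j"
    and "pcas i p j" "set p \<subseteq> S \<times> S" "i \<in> S"
  shows "path_weight A p \<le> mpow S A (length p) i j"
  using assms(3-5)
proof (induction p arbitrary: i)
  case (Cons e p)
  from Cons.prems obtain k where e: "e = (i, k)" "k \<in> S" by (cases e) auto
  have j: "j \<in> S" using Cons.prems by (induction p arbitrary: e i) auto
  have "0 \<le> path_weight A p"
    unfolding path_weight_def using Cons.prems(2) assms(2) by (intro prod_list_nonneg) fastforce
  then have "A i k * path_weight A p \<le> mpow S A 1 i k * mpow S A (length p) k j"
    using Cons e mpow_one_ge[OF assms(1), of i A k] assms(2) mpow_nonneg[OF assms(1)]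
    by (intro mult_mono') auto
  also have "\<dots> \<le> mpow S A (1 + length p) i j"
    by (rule mpow_mult_le[OF assms(1,2) e(2) j])
  finally show ?case using e by simp
qed simp

text \<open>Tracing the maximizing indices backwards turns a positive entry into an actual walk, to
  which graph arguments apply.\<close>

lemma mpow_attained_path:
  assumes "finite S" "i \<in> S" "j \<in> S" "0 < mpow S A m i j"
  obtains p where "pcas i p j" "set p \<subseteq> {(u, v). u \<in> S \<and> v \<in> S \<and> 0 < A u v}" "length p = m"
    "path_weight A p = mpow S A m i j"
  using assms(3,4)
proof (induction m arbitrary: j thesis)
  case 0
  then show ?case by (force split: if_splits)
next
  case (Suc m)
  from mpow_Suc_attained[OF assms(1) Suc.prems(3)]
  obtain k where k: "k \<in> S" "mpow S A (Suc m) i j = mpow S A m i k * A k j"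
    "0 < mpow S A m i k" "0 < A k j" .
  from Suc.IH[OF _ k(1,3)] obtain p where p: "pcas i p k"
    "set p \<subseteq> {(u, v). u \<in> S \<and> v \<in> S \<and> 0 < A u v}" "length p = m"
    "path_weight A p = mpow S A m i k" by blast
  show ?case
    by (rule Suc.prems(1)[of "p @ [(k, j)]"]) (use p k Suc.prems(2) in \<open>auto simp: pcas_append\<close>)
qed

section \<open>Entries and powers of the core matrix\<close>

lemma core_matrix_Nu_Nu: "0 \<le> A s t \<Longrightarrow> core_matrix c A (Nu s) (Nu t) = A s t"
  by (simp add: core_matrix_def msum_def)

lemma core_matrix_Mu_Nu: "core_matrix c A Mu (Nu t) = msum (\<lambda>k. A k t) {..<c}"
proof -
  have "{..<c} \<times> {t} = (\<lambda>k. (k, t)) ` {..<c}" by auto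
  then show ?thesis by (simp add: core_matrix_def msum_image)
qed

text \<open>On singleton blocks the core matrix is a renamed copy of \<open>A\<close>, hence so are
  its powers there.\<close>

lemma mpow_core_Nu:
  assumes "finite T" "\<And>i j. i \<in> T \<Longrightarrow> j \<in> T \<Longrightarrow> 0 \<le> A i j" "s \<in> T" "t \<in> T"
  shows "mpow (Nu ` T) (core_matrix c A) m (Nu s) (Nu t) = mpow T A m s t"
  using assms(4)
proof (induction m arbitrary: t)
  case (Suc m)
  then show ?case unfolding mpow.simps mmul_def msum_image
    using assms by (intro msum_cong) (simp add: core_matrix_Nu_Nu)
qed simp

section \<open>Walks in the critical graph\<close>

locale nat_digraph = pair_wf_digraph G for G :: "nat pair_pre_digraph"

text \<open>\<open>cyclicity\<close> is a gcd over cycles without repeated inner nodes only. A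
  closed walk that repeats a node splits there into two shorter closed walks, and divisibility adds
  up.\<close>

lemma (in nat_digraph) cyclicity_dvd_closed_walk:
  assumes "awalk u p u"
  shows "cyclicity G dvd length p"
  using assms
proof (induction "length p" arbitrary: p u rule: less_induct)
  case less
  show ?case
  \<comment> \<open>For nonempty \<open>p\<close> the node list begins and ends with
    \<open>u\<close>, so only its tail can be distinct.\<close>
  proof (cases "p = [] \<or> distinct (tl (awalk_verts u p))")
    case True
    then show ?thesis
      using less.prems unfolding cyclicity_def cycles_def cycle_def
      by (cases "p = []") (auto intro!: Gcd_dvd)
  next
    case False
    then obtain e es where p: "p = e # es" by (cases p) auto
    with False less.prems have es: "awalk (snd e) es u" "\<not> distinct (awalk_verts (snd e) es)"
      by (auto simp: awalk_Cons_iff)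
    from awalk_not_distinct_decomp[OF es] obtain q r s w where
      d: "es = q @ r @ s" "0 < length r" "awalk (snd e) q w" "awalk w r w" "awalk w s u"
      by blast
    have "awalk u (e # q @ s) u"
      using less.prems d p by (auto simp: awalk_Cons_iff intro: awalk_appendI)
    then have "cyclicity G dvd length (e # q @ s)" by (intro less.hyps) (use d p in auto)
    moreover have "cyclicity G dvd length r" by (rule less.hyps[OF _ d(4)]) (use d p in auto)
    ultimately have "cyclicity G dvd length (e # q @ s) + length r" by (rule dvd_add)
    then show ?thesis using d(1) p by (simp add: add_ac)
  qed
qed

context nat_digraph
begin

lemma path_mod_trans:
  "path_mod G a i j \<Longrightarrow> path_mod G b j k \<Longrightarrow> path_mod G (a + b) i k"
  unfolding path_mod_def by (metis awalk_appendI cong_add length_append)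

lemma path_mod_awalk: "awalk i p j \<Longrightarrow> path_mod G (length p) i j"
  unfolding path_mod_def by auto

lemma path_mod_cong: "path_mod G a i j \<Longrightarrow> [a = b] (mod cyclicity G) \<Longrightarrow> path_mod G b i j"
  unfolding path_mod_def by (blast intro: cong_trans)

lemma path_mod_in_verts:
  "path_mod G a i j \<Longrightarrow> i \<in> pverts G" "path_mod G a i j \<Longrightarrow> j \<in> pverts G"
  unfolding path_mod_def by (auto dest: awalk_hd_in_verts awalk_last_in_verts)

lemma strongly_connected_awalk:
  assumes "strongly_connected (with_proj G)" "u \<in> pverts G" "v \<in> pverts G"
  obtains p where "awalk u p v"
  using assms unfolding strongly_connected_def by (metis reachable_awalk with_proj_simps(1))

text \<open>Strong connectivity gives a walk back; with the given one it forms a closed walk, whose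
  length is a multiple of the cyclicity.\<close>

lemma path_mod_return:
  assumes "strongly_connected (with_proj G)" "path_mod G a i j"
  obtains q where "awalk j q i" "cyclicity G dvd a + length q"
proof -
  from assms(2) obtain p where p: "awalk i p j" "[length p = a] (mod cyclicity G)"
    unfolding path_mod_def by auto
  obtain q where q: "awalk j q i"
    using strongly_connected_awalk[OF assms(1) path_mod_in_verts(2,1)[OF assms(2)]] .
  have "cyclicity G dvd length p + length q"
    using cyclicity_dvd_closed_walk[OF awalk_appendI[OF p(1) q]] by simp
  moreover have "[length p + length q = a + length q] (mod cyclicity G)"
    using p(2) by (simp add: cong_add_rcancel_nat)
  ultimately show thesis using that q by (metis cong_0_iff cong_sym cong_trans)
qed

text \<open>Every walk back has length \<open>-a\<close> modulo the cyclicity, so a single one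
  serves all admissible \<open>b\<close>.\<close>

lemma path_mod_rev:
  assumes "strongly_connected (with_proj G)" "path_mod G a i j" "cyclicity G dvd a + b"
  shows "path_mod G b j i"
proof -
  obtain q where q: "awalk j q i" "cyclicity G dvd a + length q"
    using path_mod_return[OF assms(1,2)] .
  then have "[a + length q = a + b] (mod cyclicity G)"
    using assms(3) by (metis cong_0_iff cong_sym cong_trans)
  then have "[length q = b] (mod cyclicity G)" by (simp add: cong_add_lcancel_nat)
  then show ?thesis using path_mod_cong[OF path_mod_awalk[OF q(1)]] by blast
qed

text \<open>Symmetry comes from \<open>path_mod_rev\<close>, so \<open>path_mod G 0\<close> is an
  equivalence relation with the cyclic classes as its classes.\<close>

lemma cyclic_class_eq_iff:
  assumes "strongly_connected (with_proj G)" "i \<in> pverts G" "j \<in> pverts G"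
  shows "cyclic_class G i = cyclic_class G j \<longleftrightarrow> path_mod G 0 i j"
proof
  have "path_mod G 0 j j" using path_mod_awalk[of j "[]" j] assms(3) by (simp add: awalk_Nil_iff)
  moreover assume "cyclic_class G i = cyclic_class G j"
  ultimately show "path_mod G 0 i j" using assms(3) unfolding cyclic_class_def by blast
next
  assume ij: "path_mod G 0 i j"
  then have ji: "path_mod G 0 j i" by (rule path_mod_rev[OF assms(1)]) simp
  show "cyclic_class G i = cyclic_class G j"
    unfolding cyclic_class_def using path_mod_trans[OF ij, of 0] path_mod_trans[OF ji, of 0] by auto
qed

text \<open>One starting node \<open>i\<close> identifies the whole class that reaches
  \<open>k\<close> with residue \<open>a\<close>. This justifies following a single critical edge
  backwards and comparing class labels.\<close>

lemma path_mod_same_class: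
  assumes "strongly_connected (with_proj G)" "path_mod G a i k" "j \<in> pverts G"
  shows "path_mod G a j k \<longleftrightarrow> cyclic_class G i = cyclic_class G j"
proof -
  have i: "i \<in> pverts G" by (rule path_mod_in_verts[OF assms(2)])
  obtain q where "awalk k q i" and b: "cyclicity G dvd a + length q"
    using path_mod_return[OF assms(1,2)] .
  have ki: "path_mod G (length q) k i" using path_mod_rev[OF assms(1,2) b] .
  show ?thesis
  proof
    assume "path_mod G a j k"
    from path_mod_trans[OF this ki] have "path_mod G 0 j i"
      by (rule path_mod_cong) (use b in \<open>simp add: cong_0_iff\<close>)
    then show "cyclic_class G i = cyclic_class G j"
      using cyclic_class_eq_iff[OF assms(1,3) i] by simp
  next
    assume "cyclic_class G i = cyclic_class G j"
    then have "path_mod G 0 j i" using cyclic_class_eq_iff[OF assms(1,3) i] by simp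
    from path_mod_trans[OF this assms(2)] show "path_mod G a j k" by simp
  qed
qed

end

section \<open>The critical graph of a visualized matrix\<close>

lemma nat_digraph_digraph_of: "nat_digraph (digraph_of n A)"
  by unfold_locales (auto simp: digraph_of_def)

lemma nat_digraph_critical_graph: "nat_digraph (critical_graph n A)"
  by unfold_locales (auto simp: critical_graph_def)

locale visualized_matrix =
  fixes n c :: nat and A :: "nat \<Rightarrow> nat \<Rightarrow> real"
  assumes nonneg_matrix: "nonneg_matrix n A"
    and visualized: "visualized n A"
    and strongly_connected_critical: "strongly_connected (with_proj (critical_graph n A))"
    and pverts_critical: "pverts (critical_graph n A) = {..<c}"
begin

abbreviation "\<C> \<equiv> critical_graph n A"

sublocale D: nat_digraph "digraph_of n A"
  by (rule nat_digraph_digraph_of)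

sublocale C: nat_digraph \<C>
  by (rule nat_digraph_critical_graph)

lemma entry_nonneg: "i < n \<Longrightarrow> j < n \<Longrightarrow> 0 \<le> A i j"
  using nonneg_matrix by (auto simp: nonneg_matrix_def)

lemma entry_le_1: "i < n \<Longrightarrow> j < n \<Longrightarrow> A i j \<le> 1"
  using visualized by (auto simp: visualized_def)

lemma max_cycle_mean_eq_1: "max_cycle_mean n A = 1"
  using visualized by (simp add: visualized_def definite_def)

lemma critical_arc:
  assumes "(i, j) \<in> parcs \<C>"
  shows "i < c" "j < c" "i < n" "j < n" "A i j = 1"
proof -
  show "i < c" "j < c"
    using C.wellformed'[OF assms] pverts_critical by auto
  from assms obtain p where "D.cycle p" "(i, j) \<in> set p"
    by (auto simp: critical_graph_def critical_cycles_def cycles_def)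
  then have "(i, j) \<in> parcs (digraph_of n A)"
    unfolding D.cycle_def D.awalk_def by auto
  then show "i < n" "j < n" by (auto simp: digraph_of_def)
  show "A i j = 1" using visualized assms by (auto simp: visualized_def)
qed

text \<open>On a closed walk every node, the start included, is the head of some arc. Hence the
  predecessor lists given to the algorithm are nonempty and their \<open>hd\<close> is
  meaningful.\<close>

lemma critical_arc_into:
  assumes "i < c"
  obtains j where "(j, i) \<in> parcs \<C>"
proof -
  have "i \<in> pverts \<C>" using assms pverts_critical by simp
  then obtain p where p: "p \<in> critical_cycles n A" "i \<in> fst ` set p \<union> snd ` set p"
    unfolding critical_graph_def pair_pre_digraph.simps by blast
  then obtain u where u: "D.awalk u p u" "p \<noteq> []"
    by (auto simp: critical_cycles_def cycles_def D.cycle_def)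
  \<comment> \<open>Each tail is the head of the preceding arc, except at the start;
    \<open>last\<close> shows the end node, here equal to the start, to be a head.\<close>
  have tails: "fst ` set q \<subseteq> insert x (snd ` set q)" if "pcas x q y" for x q y
    using that by (induction q arbitrary: x) auto
  have last: "y \<in> snd ` set q" if "pcas x q y" "q \<noteq> []" for x q y
    using that by (induction q arbitrary: x) (auto split: if_splits, force)
  have "pcas u p u" using u(1) by (simp add: D.awalk_def)
  from tails[OF this] last[OF this u(2)] p(2) have "i \<in> snd ` set p" by auto
  then obtain j where "(j, i) \<in> set p" by force
  then show thesis using that p(1) unfolding critical_graph_def by auto
qed

text \<open>Otherwise \<open>n\<close> would be critical and have an incoming critical arc, but all
  arcs join nodes below \<open>n\<close>.\<close>

lemma c_le_n: "c \<le> n"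
proof (rule ccontr)
  assume "\<not> c \<le> n"
  then obtain j where "(j, n) \<in> parcs \<C>" using critical_arc_into[of n] by auto
  then show False using critical_arc(4) by auto
qed

lemma awalk_critical:
  assumes "C.awalk i p j"
  shows "pcas i p j" "set p \<subseteq> {..<n} \<times> {..<n}" "path_weight A p = 1"
proof -
  show "pcas i p j" using assms by (simp add: C.awalk_def)
  have arcs: "set p \<subseteq> parcs \<C>" using assms by (simp add: C.awalk_def)
  then show "set p \<subseteq> {..<n} \<times> {..<n}" using critical_arc by fast
  have "\<forall>e\<in>set p. A (fst e) (snd e) = 1" using arcs critical_arc(5) by auto
  then show "path_weight A p = 1" by (induction p) auto
qed

text \<open>Critical cycles are simple, the given walk need not be. For each arc, the rest of the
  walk leads from its head back to its tail and is cut down to a path; arc and path together form a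
  cycle of geometric mean 1.\<close>

lemma unit_closed_walk_critical:
  assumes "pcas u p u" "set p \<subseteq> {(i, j). i < n \<and> j < n \<and> A i j = 1}"
  shows "set p \<subseteq> parcs \<C>"
proof (rule subrelI)
  fix x y assume xy: "(x, y) \<in> set p"
  then obtain q r where p: "p = q @ (x, y) # r" by (auto simp: in_set_conv_decomp)
  have y: "y < n" and A: "A x y = 1" using xy assms(2) by auto
  have "set p \<subseteq> parcs (digraph_of n A)" using assms(2) by (auto simp: digraph_of_def)
  then have p_arcs: "set p \<subseteq> arcs (with_proj (digraph_of n A))" by simp
  obtain w where "pcas u q w" "pcas w ((x, y) # r) u"
    using assms(1) unfolding p pcas_append by blast
  then have "pcas u q x" "pcas y r u" by auto
  then have "pcas y (r @ q) x" unfolding pcas_append by blast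
  with p_arcs y have w: "D.awalk y (r @ q) x" "(x, y) \<in> parcs (digraph_of n A)"
    unfolding D.awalk_def by (simp_all add: p digraph_of_def)
  define a where "a = D.awalk_to_apath (r @ q)"
  have a: "D.apath y a x" "set a \<subseteq> set (r @ q)"
    unfolding a_def by (rule D.apath_awalk_to_apath[OF w(1)], rule D.awalk_to_apath_subset[OF w(1)])
  have cyc: "D.cycle ((x, y) # a)"
    unfolding D.cycle_def using a(1) w(2) by (intro exI[of _ x]) (auto simp: D.apath_def D.awalk_Cons_iff)
  have "\<forall>e\<in>set a. A (fst e) (snd e) = 1" using a(2) assms(2) p by fastforce
  then have "path_weight A a = 1" by (induction a) auto
  then have "(x, y) # a \<in> critical_cycles n A"
    using cyc A by (simp add: critical_cycles_def cycles_def geometric_mean_def max_cycle_mean_eq_1)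
  then show "(x, y) \<in> parcs \<C>" by (force simp: critical_graph_def)
qed

lemma path_weight_bounds:
  assumes "set p \<subseteq> {..<n} \<times> {..<n}"
  shows "0 \<le> path_weight A p" "path_weight A p \<le> 1"
proof -
  have "0 \<le> path_weight A p \<and> path_weight A p \<le> 1"
    using assms by (induction p) (auto intro!: mult_le_one simp: entry_nonneg entry_le_1)
  then show "0 \<le> path_weight A p" "path_weight A p \<le> 1" by simp_all
qed

text \<open>The entries lie in \<open>[0, 1]\<close>, so any factor below 1 would pull the product
  below 1.\<close>

lemma unit_path_weight:
  assumes "path_weight A p = 1" "set p \<subseteq> {..<n} \<times> {..<n}"
  shows "set p \<subseteq> {(i, j). i < n \<and> j < n \<and> A i j = 1}"
  using assms
proof (induction p)
  case (Cons e p)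
  then obtain i j where e: "e = (i, j)" "i < n" "j < n" by (cases e) auto
  have "0 \<le> path_weight A p" "path_weight A p \<le> 1"
    using path_weight_bounds[of p] Cons.prems(2) by auto
  moreover have "A i j * path_weight A p = 1" using Cons.prems(1) e by simp
  moreover have "0 \<le> A i j" "A i j \<le> 1" using e entry_nonneg entry_le_1 by auto
  ultimately have "A i j = 1" "path_weight A p = 1"
    by (metis mult.commute mult_left_le mult_left_le_one_le order_antisym)+
  then show ?case using Cons e by auto
qed simp

text \<open>A walk of weight 1 is closed up through the strongly connected critical graph.\<close>

lemma unit_walk_critical:
  assumes "pcas i p k" "set p \<subseteq> {..<n} \<times> {..<n}" "path_weight A p = 1" "i < c" "k < c"
  shows "C.awalk i p k"
proof -
  obtain q where q: "C.awalk k q i"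
    using C.strongly_connected_awalk[OF strongly_connected_critical] pverts_critical assms(4,5) by blast
  have "set (p @ q) \<subseteq> parcs \<C>"
    using assms(1-3) awalk_critical[OF q]
    by (intro unit_closed_walk_critical[of i] unit_path_weight) (auto simp: pcas_append simp del: C.cas_append_iff D.cas_append_iff)
  then show ?thesis using assms(1,4) pverts_critical by (auto simp: C.awalk_def)
qed

text \<open>Cycles that avoid the critical nodes have weight less than 1, so cutting one out gains weight.\<close>

lemma noncritical_walk_shorten:
  assumes "pcas s p t" "set p \<subseteq> {c..<n} \<times> {c..<n}" "s \<in> {c..<n}" "0 < path_weight A p"
    "n - c \<le> length p"
  shows "\<exists>q. pcas s q t \<and> set q \<subseteq> {c..<n} \<times> {c..<n} \<and> length q < n - c \<and>
    path_weight A p < path_weight A q"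
  using assms
proof (induction "length p" arbitrary: p rule: less_induct)
  case less
  have nz: "\<forall>e\<in>set p. A (fst e) (snd e) \<noteq> 0"
  proof (intro ballI notI)
    fix e assume "e \<in> set p" "A (fst e) (snd e) = 0"
    then have "path_weight A p = 0" by (induction p) auto
    then show False using less.prems(4) by simp
  qed
  have "set p \<subseteq> parcs (digraph_of n A)"
  proof (rule subrelI)
    fix x y assume "(x, y) \<in> set p"
    then show "(x, y) \<in> parcs (digraph_of n A)"
      using nz less.prems(2) by (fastforce simp: digraph_of_def)
  qed
  moreover have "s \<in> pverts (digraph_of n A)" using less.prems(3) by (simp add: digraph_of_def)
  ultimately have w: "D.awalk s p t" using less.prems(1) by (simp add: D.awalk_def)
  \<comment> \<open>Pigeonhole: the node list has \<open>length p + 1 > n - c\<close> positions, but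
    only \<open>n - c\<close> nodes are available.\<close>
  have "set (D.awalk_verts s p) \<subseteq> {c..<n}"
    unfolding D.set_awalk_verts[OF w] using less.prems(2,3) by auto
  then have "card (set (D.awalk_verts s p)) \<le> n - c"
    using card_mono[of "{c..<n}"] by auto
  then have "\<not> distinct (D.awalk_verts s p)"
    using less.prems(5) distinct_card[of "D.awalk_verts s p"] D.length_awalk_verts[of s p] by force
  from D.awalk_not_distinct_decomp[OF w this] obtain a r b v where
    d: "p = a @ r @ b" "0 < length r" "D.awalk s a v" "D.awalk v r v" "D.awalk v b t"
    by blast
  then have cas: "pcas s (a @ b) t" "pcas v r v" by (auto simp: D.awalk_def pcas_append)
  have r: "set r \<subseteq> {..<n} \<times> {..<n}" using less.prems(2) d(1) by auto
  \<comment> \<open>A closed walk of weight 1 would consist of critical arcs, with nodes below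
    \<open>c\<close>, whereas \<open>r\<close> avoids them.\<close>
  have "path_weight A r \<noteq> 1"
  proof
    assume "path_weight A r = 1"
    then have "set r \<subseteq> parcs \<C>"
      using unit_closed_walk_critical[OF cas(2)] unit_path_weight[OF _ r] by blast
    moreover obtain x y where xy: "(x, y) \<in> set r" using d(2) by (cases r) auto
    ultimately have "x < c" using critical_arc(1) by auto
    moreover have "c \<le> x" using less.prems(2) d(1) xy by auto
    ultimately show False by simp
  qed
  then have r1: "path_weight A r < 1" using path_weight_bounds(2)[OF r] by linarith
  have pos: "0 < path_weight A a * path_weight A b"
  proof -
    have "0 \<le> path_weight A a" "0 \<le> path_weight A b"
      using less.prems(2) d(1) by (auto intro!: path_weight_bounds(1))
    then show ?thesis using less.prems(4) d(1)
      by (metis less_eq_real_def mult_eq_0_iff mult_nonneg_nonneg path_weight_simps(3))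
  qed
  have lt: "path_weight A p < path_weight A (a @ b)"
    using mult_strict_left_mono[OF r1 pos] by (simp add: d(1) mult_ac)
  show ?case
  proof (cases "length (a @ b) < n - c")
    case True
    then show ?thesis using lt cas(1) less.prems(2) d(1) by (intro exI[of _ "a @ b"]) auto
  next
    case False
    \<comment> \<open>One cut may leave a walk that is still too long; the induction cuts further,
      and the strict gains compose.\<close>
    have "\<exists>q. pcas s q t \<and> set q \<subseteq> {c..<n} \<times> {c..<n} \<and> length q < n - c \<and>
      path_weight A (a @ b) < path_weight A q"
      using cas(1) less.prems(2,3) d(1,2) pos False by (intro less.hyps) auto
    then show ?thesis using lt less_trans by blast
  qed
qed

end

section \<open>The coefficients of the attraction system\<close>

text \<open>The core has one index more than the non-critical submatrix, so its star admits walks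
  longer by one edge: the one leaving \<open>Mu\<close>.\<close>

lemma core_indices_simps:
  shows finite_core_indices: "finite (core_indices n c)"
    and card_core_indices: "card (core_indices n c) = Suc (n - c)"
    and core_indices_minus_Mu: "core_indices n c - {Mu} = Nu ` {c..<n}"
proof -
  have "card (Nu ` {c..<n}) = n - c" by (subst card_image) (auto simp: inj_on_def)
  moreover have "Mu \<notin> Nu ` {c..<n}" by auto
  ultimately show "card (core_indices n c) = Suc (n - c)" by (simp add: core_indices_def)
qed (auto simp: core_indices_def)

context visualized_matrix
begin

definition h :: "nat \<Rightarrow> real" where
  "h s = msum (\<lambda>k. A k s) {..<c}"

definition bstar :: "nat \<Rightarrow> nat \<Rightarrow> real" where
  "bstar s t = msum (\<lambda>m. mpow {c..<n} A m s t) {..<n - c}"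

text \<open>The coefficient as the algorithm forms it, \<open>h\<^sup>T \<otimes> B\<^sup>*\<close>,
  with \<open>bstar\<close> holding the entries of \<open>B\<^sup>*\<close>.\<close>

definition \<alpha> :: "nat \<Rightarrow> real" where
  "\<alpha> t = msum (\<lambda>s. h s * bstar s t) {c..<n}"

text \<open>The condition \<open>G\<^sub>t(i) = 1\<close>, with the class \<open>[\<rightarrow>\<^sub>m\<^sub>+\<^sub>1 i]\<close> written out.\<close>

definition selected :: "nat \<Rightarrow> nat \<Rightarrow> bool" where
  "selected i t \<longleftrightarrow> (\<exists>s\<in>{c..<n}. h s * bstar s t = \<alpha> t \<and>
     (\<exists>m<n - c. mpow {c..<n} A m s t = bstar s t \<and>
       (\<exists>k<c. A k s = h s \<and> path_mod \<C> (Suc m) k i)))"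

lemma h_nonneg: "0 \<le> h s"
  unfolding h_def by (simp add: msum_nonneg)

lemma h_ge: "k < c \<Longrightarrow> A k s \<le> h s"
  unfolding h_def by (rule msum_ge) auto

lemma bstar_nonneg: "0 \<le> bstar s t"
  unfolding bstar_def by (simp add: msum_nonneg)

lemma alpha_nonneg: "0 \<le> \<alpha> t"
  unfolding \<alpha>_def by (simp add: msum_nonneg)

lemma alpha_ge: "s \<in> {c..<n} \<Longrightarrow> h s * bstar s t \<le> \<alpha> t"
  unfolding \<alpha>_def by (rule msum_ge) auto

lemma bstar_ge: "m < n - c \<Longrightarrow> mpow {c..<n} A m s t \<le> bstar s t"
  unfolding bstar_def by (rule msum_ge) auto

lemma core_matrix_bounds:
  assumes "\<rho> \<in> core_indices n c" "\<sigma> \<in> core_indices n c"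
  shows "0 \<le> core_matrix c A \<rho> \<sigma>" "core_matrix c A \<rho> \<sigma> \<le> 1"
proof -
  have sub: "block c \<rho> \<subseteq> {..<n}" "block c \<sigma> \<subseteq> {..<n}"
    using assms c_le_n by (auto simp: core_indices_def)
  then have fin: "finite (block c \<rho> \<times> block c \<sigma>)" by (auto intro: finite_subset)
  show "0 \<le> core_matrix c A \<rho> \<sigma>" unfolding core_matrix_def by (rule msum_nonneg[OF fin])
  show "core_matrix c A \<rho> \<sigma> \<le> 1" unfolding core_matrix_def
    using sub entry_le_1 by (subst msum_le_iff[OF fin]) auto
qed

text \<open>A core walk is split at its last visit to \<open>Mu\<close>: the closed part has weight
  at most 1, the exit edge has weight \<open>h s\<close>, and the rest is non-critical. Conversely,
  the edge from \<open>Mu\<close> to \<open>Nu s\<close> can be put before any non-critical walk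
  from \<open>s\<close>.\<close>

lemma core_star_eq_alpha:
  assumes t: "t \<in> {c..<n}"
  shows "core_star n c A Mu (Nu t) = \<alpha> t"
proof (rule antisym)
  let ?I = "core_indices n c" and ?M = "core_matrix c A"
  note fin = finite_core_indices[of n c]
  have Mu: "Mu \<in> ?I" and tI: "Nu t \<in> ?I - {Mu}" and I: "Nu s \<in> ?I \<longleftrightarrow> s \<in> {c..<n}" for s
    using t by (auto simp: core_indices_def)
  have "mpow ?I ?M k Mu (Nu t) \<le> \<alpha> t" if "k < Suc (n - c)" for k
  proof (cases "0 < mpow ?I ?M k Mu (Nu t)")
    case True
    have "\<exists>\<rho>\<in>{Mu}. \<exists>\<sigma>\<in>?I - {Mu}. \<exists>l m. k = l + 1 + m \<and>
        mpow ?I ?M k Mu (Nu t) \<le> mpow ?I ?M l Mu \<rho> * ?M \<rho> \<sigma> * mpow (?I - {Mu}) ?M m \<sigma> (Nu t)"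
      by (rule mpow_last_visit) (use True fin Mu tI core_matrix_bounds(1) in auto)
    then obtain s l m where s: "s \<in> {c..<n}" "k = l + 1 + m" and
      le: "mpow ?I ?M k Mu (Nu t) \<le> mpow ?I ?M l Mu Mu * ?M Mu (Nu s) * mpow (Nu ` {c..<n}) ?M m (Nu s) (Nu t)"
      unfolding core_indices_minus_Mu by blast
    have "mpow ?I ?M l Mu Mu \<le> 1"
      by (rule mpow_le_1[OF fin _ Mu]) (use core_matrix_bounds in auto)
    then have "mpow ?I ?M l Mu Mu * (h s * mpow {c..<n} A m s t) \<le> h s * mpow {c..<n} A m s t"
      using h_nonneg
      by (intro mult_left_le_one_le mult_nonneg_nonneg mpow_nonneg fin) auto
    then have "mpow ?I ?M k Mu (Nu t) \<le> h s * mpow {c..<n} A m s t"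
      using le s(1) t mpow_core_Nu[where T = "{c..<n}" and A = A] entry_nonneg
      by (simp add: core_matrix_Mu_Nu h_def mult.assoc)
    \<comment> \<open>From \<open>k \<le> n - c\<close> and \<open>k = l + 1 + m\<close> follows
      \<open>m < n - c\<close>, the range covered by \<open>bstar\<close>.\<close>
    also have "\<dots> \<le> h s * bstar s t"
      using s(2) that by (intro mult_left_mono bstar_ge h_nonneg) auto
    also have "\<dots> \<le> \<alpha> t" by (rule alpha_ge[OF s(1)])
    finally show ?thesis .
  qed (use alpha_nonneg[of t] in auto)
  then show "core_star n c A Mu (Nu t) \<le> \<alpha> t"
    unfolding core_star_def kleene_star_def card_core_indices
    by (subst msum_le_iff) (auto simp: alpha_nonneg)
  have star_nonneg: "0 \<le> core_star n c A Mu (Nu t)"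
    unfolding core_star_def kleene_star_def by (rule msum_nonneg) auto
  have "h s * bstar s t \<le> core_star n c A Mu (Nu t)" if s: "s \<in> {c..<n}" for s
  proof (cases "0 < bstar s t")
    case True
    then obtain m where m: "m < n - c" "bstar s t = mpow {c..<n} A m s t"
      unfolding bstar_def using msum_attained[of "{..<n - c}"] by (metis finite_lessThan lessThan_iff)
    have "mpow {c..<n} A m s t = mpow (Nu ` {c..<n}) ?M m (Nu s) (Nu t)"
      using s t entry_nonneg by (intro mpow_core_Nu[symmetric]) auto
    also have "\<dots> \<le> mpow ?I ?M m (Nu s) (Nu t)"
      using s t by (intro mpow_mono_set[OF fin _ core_matrix_bounds(1)]) (auto simp: core_indices_def)
    finally have "h s * bstar s t \<le> mpow ?I ?M 1 Mu (Nu s) * mpow ?I ?M m (Nu s) (Nu t)"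
      using mpow_one_ge[OF fin Mu, of ?M "Nu s"] m(2) h_nonneg bstar_nonneg[of s t]
      by (intro mult_mono) (auto simp: core_matrix_Mu_Nu h_def mpow_nonneg[OF fin] simp del: mpow.simps)
    also have "\<dots> \<le> mpow ?I ?M (1 + m) Mu (Nu t)"
      using s t by (intro mpow_mult_le[OF fin core_matrix_bounds(1)]) (auto simp: core_indices_def)
    also have "\<dots> \<le> core_star n c A Mu (Nu t)"
      unfolding core_star_def kleene_star_def card_core_indices
      using m(1) by (intro msum_ge) auto
    finally show ?thesis .
  next
    case False
    then have "bstar s t = 0" using bstar_nonneg[of s t] by linarith
    then show ?thesis using star_nonneg by simp
  qed
  then show "\<alpha> t \<le> core_star n c A Mu (Nu t)"
    unfolding \<alpha>_def using star_nonneg by (subst msum_le_iff) auto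
qed

text \<open>The strictness later confines an optimal non-critical tail to exponents below
  \<open>n - c\<close>, the ones the algorithm records.\<close>

lemma long_noncritical_power:
  assumes "s \<in> {c..<n}" "t \<in> {c..<n}" "n - c \<le> m" "0 < mpow {c..<n} A m s t"
  shows "mpow {c..<n} A m s t < bstar s t"
proof -
  obtain p where p: "pcas s p t" "set p \<subseteq> {(u, v). u \<in> {c..<n} \<and> v \<in> {c..<n} \<and> 0 < A u v}"
    "length p = m" "path_weight A p = mpow {c..<n} A m s t"
    by (rule mpow_attained_path[OF _ assms(1,2,4)]) auto
  have "set p \<subseteq> {c..<n} \<times> {c..<n}" using p(2) by auto
  then obtain q where q: "pcas s q t" "set q \<subseteq> {c..<n} \<times> {c..<n}" "length q < n - c"
    "path_weight A p < path_weight A q"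
    using noncritical_walk_shorten[OF p(1)] assms p(3,4) by auto
  have "path_weight A q \<le> mpow {c..<n} A (length q) s t"
    using q assms(1) entry_nonneg by (intro path_weight_le_mpow) auto
  also have "\<dots> \<le> bstar s t" by (rule bstar_ge[OF q(3)])
  finally show ?thesis using q(4) p(4) by simp
qed

text \<open>Since long powers gain nothing, the truncated maximum \<open>bstar\<close> dominates
  every power.\<close>

lemma noncritical_power_le:
  assumes "s \<in> {c..<n}" "t \<in> {c..<n}"
  shows "mpow {c..<n} A m s t \<le> bstar s t"
  using bstar_ge[of m s t] long_noncritical_power[OF assms, of m] bstar_nonneg[of s t]
  by (cases "m < n - c"; cases "0 < mpow {c..<n} A m s t") auto

lemma split_power:
  assumes "i < c" "t \<in> {c..<n}" "0 < mpow {..<n} A r i t"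
  obtains k s l m where "k < c" "s \<in> {c..<n}" "r = l + 1 + m"
    "mpow {..<n} A r i t \<le> mpow {..<n} A l i k * (A k s * mpow {c..<n} A m s t)"
proof -
  have eq: "{..<n} - {..<c} = {c..<n}" by auto
  have "\<exists>k\<in>{..<c}. \<exists>s\<in>{..<n} - {..<c}. \<exists>l m. r = l + 1 + m \<and>
      mpow {..<n} A r i t \<le> mpow {..<n} A l i k * A k s * mpow ({..<n} - {..<c}) A m s t"
    by (rule mpow_last_visit) (use assms c_le_n entry_nonneg in auto)
  then obtain k s l m where "k < c" "s \<in> {c..<n}" "r = l + 1 + m"
    "mpow {..<n} A r i t \<le> mpow {..<n} A l i k * A k s * mpow {c..<n} A m s t"
    unfolding eq by blast
  then show thesis using that[of k s l m] by (simp add: mult.assoc)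
qed

lemma power_factor_bounds:
  assumes "k < c" "s \<in> {c..<n}" "t \<in> {c..<n}"
  shows "A k s * mpow {c..<n} A m s t \<le> h s * bstar s t"
  using assms entry_nonneg c_le_n
  by (intro mult_mono h_ge noncritical_power_le h_nonneg mpow_nonneg) auto

lemma mpow_le_alpha:
  assumes "i < c" "t \<in> {c..<n}"
  shows "mpow {..<n} A r i t \<le> \<alpha> t"
proof (cases "0 < mpow {..<n} A r i t")
  case True
  then obtain k s l m where k: "k < c" "s \<in> {c..<n}" and
    le: "mpow {..<n} A r i t \<le> mpow {..<n} A l i k * (A k s * mpow {c..<n} A m s t)"
    using split_power[OF assms] by metis
  note le
  also have "\<dots> \<le> A k s * mpow {c..<n} A m s t"
    using k c_le_n entry_nonneg entry_le_1
    by (intro mult_left_le_one_le mpow_le_1 mult_nonneg_nonneg mpow_nonneg) auto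
  also have "\<dots> \<le> h s * bstar s t" by (rule power_factor_bounds[OF k assms(2)])
  also have "\<dots> \<le> \<alpha> t" by (rule alpha_ge[OF k(2)])
  finally show ?thesis .
qed (use alpha_nonneg[of t] in auto)

text \<open>For positive \<open>\<alpha> t\<close> the chain \<open>\<alpha> t \<le> x * (A k s * y)
  \<le> A k s * y \<le> h s * bstar s t \<le> \<alpha> t\<close> collapses to equalities, so each
  factor attains its maximum and the critical part has weight 1.\<close>

lemma selected_if_power_eq:
  assumes i: "i < c" and t: "t \<in> {c..<n}" and dvd: "cyclicity \<C> dvd r"
    and eq: "mpow {..<n} A r i t = \<alpha> t"
  shows "selected i t"
proof (cases "0 < \<alpha> t")
  case True
  then have pos: "0 < mpow {..<n} A r i t" by (simp add: eq)
  obtain k s l m where k: "k < c" and s: "s \<in> {c..<n}" and r: "r = l + 1 + m" and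
    le: "\<alpha> t \<le> mpow {..<n} A l i k * (A k s * mpow {c..<n} A m s t)"
    by (rule split_power[OF i t pos, unfolded eq])
  define x y where "x = mpow {..<n} A l i k" and "y = mpow {c..<n} A m s t"
  have x: "0 \<le> x" "x \<le> 1" unfolding x_def
    using k c_le_n entry_nonneg entry_le_1 by (auto intro!: mpow_nonneg mpow_le_1)
  have y: "0 \<le> y" "y \<le> bstar s t" unfolding y_def
    using noncritical_power_le[OF s t] by (auto intro!: mpow_nonneg)
  have a: "0 \<le> A k s" "A k s \<le> h s" using k s c_le_n entry_nonneg h_ge by auto
  have ay: "A k s * y \<le> h s * bstar s t" "h s * bstar s t \<le> \<alpha> t"
    using power_factor_bounds[OF k s t] alpha_ge[OF s] by (auto simp: y_def)
  have x_ay: "x * (A k s * y) \<le> A k s * y"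
    using x a y by (intro mult_left_le_one_le) auto
  have le': "\<alpha> t \<le> x * (A k s * y)" using le by (simp add: x_def y_def)
  have ay_eq: "A k s * y = \<alpha> t" "h s * bstar s t = \<alpha> t" using le' x_ay ay by linarith+
  then have "x = 1" using le' x True by (metis mult.commute mult_le_cancel_left1 not_less order_antisym)
  have pos: "0 < A k s" "0 < y" using ay_eq(1) True a(1) y(1) by (metis less_eq_real_def mult_eq_0_iff)+
  have "A k s * bstar s t \<le> h s * bstar s t" using a(2) y by (intro mult_right_mono) auto
  then have "A k s * bstar s t \<le> A k s * y" using ay_eq by simp
  then have y_eq: "y = bstar s t" using pos(1) y(2) by simp
  then have a_eq: "A k s = h s" using ay_eq pos(2) by (metis less_irrefl mult_cancel_right)
  \<comment> \<open>A tail of length at least \<open>n - c\<close> would be strictly below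
    \<open>bstar s t\<close>, contrary to \<open>y_eq\<close>.\<close>
  have m: "m < n - c" using long_noncritical_power[OF s t, of m] y_eq pos(2) unfolding y_def by fastforce
  have ik: "i \<in> {..<n}" "k \<in> {..<n}" "0 < mpow {..<n} A l i k"
    using i k c_le_n \<open>x = 1\<close> by (auto simp: x_def)
  obtain p where p: "pcas i p k" "set p \<subseteq> {(u, v). u \<in> {..<n} \<and> v \<in> {..<n} \<and> 0 < A u v}"
    "length p = l" "path_weight A p = 1"
    by (rule mpow_attained_path[OF _ ik]) (use \<open>x = 1\<close> in \<open>simp_all add: x_def\<close>)
  have "C.awalk i p k" using p i k by (intro unit_walk_critical) auto
  then have "path_mod \<C> l i k" using C.path_mod_awalk p(3) by blast
  \<comment> \<open>Here \<open>l + Suc m = r\<close> is a multiple of the cyclicity, so reversing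
    residue \<open>l\<close> yields \<open>Suc m\<close>.\<close>
  then have "path_mod \<C> (Suc m) k i"
    using C.path_mod_rev[OF strongly_connected_critical] dvd r by simp
  then show ?thesis unfolding selected_def using s m k y_eq a_eq ay_eq(2) unfolding y_def by blast
next
  \<comment> \<open>No walk realizes \<open>\<alpha> t = 0\<close>, but then \<open>h t = 0\<close>, every critical node attains \<open>h t\<close>,
    and the empty walk at \<open>t\<close> is a witness.\<close>
  case False
  then have alpha: "\<alpha> t = 0" using alpha_nonneg[of t] by linarith
  have m: "0 < n - c" using t by auto
  have "bstar t t \<le> 1" unfolding bstar_def
    using t entry_nonneg entry_le_1 by (subst msum_le_iff) (auto intro!: mpow_le_1)
  then have b: "bstar t t = 1" using bstar_ge[OF m, of t t] by simp
  then have h: "h t = 0" using alpha_ge[OF t, of t] alpha h_nonneg[of t] by simp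
  obtain k where k: "(k, i) \<in> parcs \<C>" using critical_arc_into[OF i] .
  have kc: "k < c" "k < n" using critical_arc[OF k] by auto
  have "A k t = h t" using h_ge[OF kc(1), of t] entry_nonneg[OF kc(2), of t] t h by auto
  moreover have "path_mod \<C> (Suc 0) k i"
    using C.path_mod_awalk[of k "[(k, i)]" i] k C.wellformed'[OF k]
    by (simp add: C.awalk_Cons_iff C.awalk_Nil_iff)
  ultimately show ?thesis
    unfolding selected_def using alpha h b m t kc(1)
    by (intro bexI[of _ t] conjI exI[of _ 0] exI[of _ k]) auto
qed

text \<open>The witnesses \<open>k\<close>, \<open>s\<close>, \<open>m\<close> assemble to a walk of
  weight \<open>\<alpha> t\<close>. Closed critical walks at \<open>i\<close> lengthen it beyond
  \<open>r\<close> without changing the weight, and periodicity carries the value back to exponent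
  \<open>r\<close>.\<close>

lemma power_eq_if_selected:
  assumes "is_transient n A T" "T \<le> r" and dvd: "cyclicity \<C> dvd r"
    and i: "i < c" and t: "t \<in> {c..<n}" and sel: "selected i t"
  shows "mpow {..<n} A r i t = \<alpha> t"
proof (rule antisym[OF mpow_le_alpha[OF i t]])
  obtain s m k where s: "s \<in> {c..<n}" "h s * bstar s t = \<alpha> t" and m: "m < n - c"
    "mpow {c..<n} A m s t = bstar s t" and k: "k < c" "A k s = h s" "path_mod \<C> (Suc m) k i"
    using sel unfolding selected_def by blast
  let ?\<gamma> = "cyclicity \<C>"
  obtain q where q: "C.awalk i q k" "?\<gamma> dvd Suc m + length q"
    using C.path_mod_return[OF strongly_connected_critical k(3)] .
  obtain j where j: "(j, i) \<in> parcs \<C>" using critical_arc_into[OF i] .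
  obtain w where w: "C.awalk i w j"
    using C.strongly_connected_awalk[OF strongly_connected_critical] pverts_critical i critical_arc(1)[OF j]
    by blast
  \<comment> \<open>The final arc makes \<open>z\<close> nonempty, so \<open>r\<close> copies of it
    have length at least \<open>r\<close>.\<close>
  define z where "z = w @ [(j, i)]"
  have z: "C.awalk i z i" unfolding z_def
    by (rule C.awalk_appendI[OF w]) (use j C.wellformed'[OF j] in \<open>simp add: C.awalk_Cons_iff C.awalk_Nil_iff\<close>)
  have zs: "C.awalk i (concat (replicate e z)) i" for e
    by (induction e) (use z i pverts_critical in \<open>auto simp: C.awalk_Nil_iff intro: C.awalk_appendI simp del: C.awalk_append_iff\<close>)
  define p where "p = concat (replicate r z) @ q"
  have p: "C.awalk i p k" unfolding p_def by (rule C.awalk_appendI[OF zs q(1)])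
  define L where "L = length p + 1 + m"
  have "r \<le> length (concat (replicate r z))" by (simp add: length_concat sum_list_replicate z_def)
  then have "r \<le> L" unfolding L_def p_def by simp
  have "?\<gamma> dvd length (concat (replicate r z)) + (Suc m + length q)"
    by (rule dvd_add[OF C.cyclicity_dvd_closed_walk[OF zs] q(2)])
  \<comment> \<open>Both lengths are multiples of the cyclicity, so they differ by whole
    periods.\<close>
  then have "?\<gamma> dvd L - r" using dvd by (intro dvd_diff_nat) (auto simp: L_def p_def add_ac)
  then obtain e where L: "L = r + e * ?\<gamma>" using \<open>r \<le> L\<close>
    by (metis dvd_def le_add_diff_inverse mult.commute)
  have periodic: "mpow {..<n} A (r + e * ?\<gamma>) i t = mpow {..<n} A r i t"
  proof (induction e)
    case (Suc e)
    have "mpow {..<n} A (r + e * ?\<gamma> + ?\<gamma>) i t = mpow {..<n} A (r + e * ?\<gamma>) i t"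
      using assms(1,2) i t c_le_n unfolding is_transient_def Let_def by simp
    then show ?case using Suc by (simp add: add_ac)
  qed simp
  have "\<alpha> t = path_weight A p * (A k s * mpow {c..<n} A m s t)"
    using awalk_critical(3)[OF p] s(2) m(2) k(2) by simp
  also have "\<dots> \<le> mpow {..<n} A (length p) i k * (mpow {..<n} A 1 k s * mpow {..<n} A m s t)"
  proof (intro mult_mono)
    show "path_weight A p \<le> mpow {..<n} A (length p) i k"
      using awalk_critical[OF p] i c_le_n entry_nonneg by (intro path_weight_le_mpow) auto
    show "A k s \<le> mpow {..<n} A 1 k s" using k(1) c_le_n by (intro mpow_one_ge) auto
    show "mpow {c..<n} A m s t \<le> mpow {..<n} A m s t"
      using s t entry_nonneg by (intro mpow_mono_set) auto
  qed (use k s c_le_n entry_nonneg h_nonneg in \<open>auto intro!: mpow_nonneg mult_nonneg_nonneg simp del: mpow.simps\<close>)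
  also have "\<dots> \<le> mpow {..<n} A (length p) i k * mpow {..<n} A (1 + m) k t"
    using s(1) t entry_nonneg by (intro mult_left_mono mpow_mult_le mpow_nonneg) auto
  also have "\<dots> \<le> mpow {..<n} A (length p + (1 + m)) i t"
    using k(1) t c_le_n entry_nonneg by (intro mpow_mult_le) auto
  also have "\<dots> = mpow {..<n} A r i t" using periodic L by (simp add: L_def add_ac)
  finally show "\<alpha> t \<le> mpow {..<n} A r i t" .
qed

lemma K_set_eq:
  assumes "is_transient n A T" "T \<le> r" "cyclicity \<C> dvd r" "i < c"
  shows "K_set n c A r i = {t \<in> {c..<n}. selected i t}"
  unfolding K_set_def
  using selected_if_power_eq[OF assms(4) _ assms(3)] power_eq_if_selected[OF assms(1-4)]
  by (auto simp: core_star_eq_alpha)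

end

section \<open>Correctness and cost of the algorithm\<close>

text \<open>A Hoare-style judgement with an operation budget \<open>b\<close>. Quantifying over the
  initial counter makes budgets additive under sequencing.\<close>

definition computes :: "'a counted \<Rightarrow> nat \<Rightarrow> ('a \<Rightarrow> bool) \<Rightarrow> bool" where
  "computes m b Q \<longleftrightarrow> (\<forall>s. \<exists>v s'. run_state m s = (v, s') \<and> s' \<le> s + b \<and> Q v)"

lemma computes_return: "Q v \<Longrightarrow> computes (State_Monad.return v) b Q"
  by (simp add: computes_def)

lemma computes_mono:
  "computes m d P \<Longrightarrow> d \<le> b \<Longrightarrow> (\<And>v. P v \<Longrightarrow> Q v) \<Longrightarrow> computes m b Q"
  unfolding computes_def by (meson add_left_mono le_trans)

lemma computes_bind:
  fixes m :: "'a counted" and f :: "'a \<Rightarrow> 'b counted"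
  assumes "computes m d P" "d \<le> b" "\<And>v. P v \<Longrightarrow> computes (f v) (b - d) Q"
  shows "computes (do { v \<leftarrow> m; f v }) b Q"
  unfolding computes_def
proof
  fix s
  obtain v s1 where 1: "run_state m s = (v, s1)" "s1 \<le> s + d" "P v"
    using assms(1) unfolding computes_def by meson
  moreover obtain w s2 where "run_state (f v) s1 = (w, s2)" "s2 \<le> s1 + (b - d)" "Q w"
    using assms(3)[OF 1(3)] unfolding computes_def by meson
  ultimately show "\<exists>v s'. run_state (do { v \<leftarrow> m; f v }) s = (v, s') \<and> s' \<le> s + b \<and> Q v"
    using assms(2) by simp
qed

lemma run_state_update [simp]: "run_state (State_Monad.update f) s = ((), f s)"
  by (simp add: State_Monad.update_def)

lemma computes_prim:
  shows computes_op1: "Q (g x) \<Longrightarrow> 0 < b \<Longrightarrow> computes (op1 g x) b Q"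
    and computes_op2: "Q (k x y) \<Longrightarrow> 0 < b \<Longrightarrow> computes (op2 k x y) b Q"
    and computes_rd: "Q (a i) \<Longrightarrow> 0 < b \<Longrightarrow> computes (rd a i) b Q"
    and computes_wr: "R (a'(i' := v)) \<Longrightarrow> 0 < b \<Longrightarrow> computes (wr a' i' v) b R"
  by (auto simp: computes_def op1_def op2_def rd_def wr_def)

text \<open>These rules run backwards: the exact result is substituted into the continuation and the
  budget drops by one, so straight-line code needs no intermediate assertions.\<close>

lemma computes_bind_prim:
  fixes f :: "_ \<Rightarrow> _ counted"
  shows computes_bind_op1: "computes (f (g x)) (b - 1) Q \<Longrightarrow> 0 < b \<Longrightarrow> computes (do { v \<leftarrow> op1 g x; f v }) b Q"
    and computes_bind_op2: "computes (f (k x y)) (b - 1) Q \<Longrightarrow> 0 < b \<Longrightarrow> computes (do { v \<leftarrow> op2 k x y; f v }) b Q"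
    and computes_bind_rd: "computes (f (a i)) (b - 1) Q \<Longrightarrow> 0 < b \<Longrightarrow> computes (do { v \<leftarrow> rd a i; f v }) b Q"
  by (rule computes_bind[where P = "\<lambda>v. v = _"], rule computes_prim, rule refl, auto)+

lemma computes_bind_wr:
  fixes f :: "_ \<Rightarrow> _ counted"
  shows "computes (f (a(i := v))) (b - 1) Q \<Longrightarrow> 0 < b \<Longrightarrow> computes (do { a \<leftarrow> wr a i v; f a }) b Q"
  by (rule computes_bind[where P = "\<lambda>v. v = _"], rule computes_prim, rule refl, auto)

lemma computes_if:
  "(P \<Longrightarrow> computes m b Q) \<Longrightarrow> (\<not> P \<Longrightarrow> computes m' b Q) \<Longrightarrow> computes (if P then m else m') b Q"
  by simp

lemma computes_case_prod:
  "(\<And>x y. p = (x, y) \<Longrightarrow> computes (f x y) b Q) \<Longrightarrow> computes (case_prod f p) b Q"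
  by (cases p) simp

lemmas computes_intros =
  computes_return computes_prim computes_bind_prim computes_bind_wr computes_if

text \<open>The invariant is indexed by the next loop index; \<open>Suc d\<close> includes the
  operation charged for the iteration itself.\<close>

lemma computes_for_each:
  assumes "a \<le> e" "I a s" "(e - a) * Suc d \<le> b"
    and "\<And>k s. a \<le> k \<Longrightarrow> k < e \<Longrightarrow> I k s \<Longrightarrow> computes (f k s) d (I (Suc k))"
  shows "computes (for_each [a..<e] s f) b (I e)"
  using assms
proof (induction "e - a" arbitrary: a s b)
  case 0
  then show ?case by (auto intro: computes_return)
next
  case (Suc x)
  then have ea: "a < e" "e - a = Suc (e - Suc a)" by simp_all
  have "computes (do { State_Monad.update Suc; s' \<leftarrow> f a s; for_each [Suc a..<e] s' f }) b (I e)"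
  proof (rule computes_bind[where P = "\<lambda>_. True" and d = 1], goal_cases)
    case 3
    show ?case
    proof (rule computes_bind[where P = "I (Suc a)" and d = d], goal_cases)
      case 1
      show ?case using Suc.prems ea(1) by simp
    next
      case 2
      show ?case using Suc.prems(3) ea(2) by simp
    next
      case (3 v)
      show ?case
        by (rule Suc.hyps(1)) (use Suc.prems Suc.hyps(2) ea 3 in auto)
    qed
  qed (use Suc.prems(3) ea(2) in \<open>auto simp: computes_def\<close>)
  then show ?case using ea(1) by (simp add: upt_conv_Cons)
qed

text \<open>New arrays are unspecified, so loop invariants state which cells are already written.\<close>

definition agrees :: "('i \<Rightarrow> 'a) \<Rightarrow> 'i set \<Rightarrow> ('i \<Rightarrow> 'a) \<Rightarrow> bool" where
  "agrees g X a \<longleftrightarrow> (\<forall>x\<in>X. a x = g x)"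

lemma agrees_empty [simp]: "agrees g {} a"
  by (simp add: agrees_def)

lemma agreesD: "agrees g X a \<Longrightarrow> x \<in> X \<Longrightarrow> a x = g x"
  by (simp add: agrees_def)

lemma agrees_upd: "agrees g X a \<Longrightarrow> v = g x \<Longrightarrow> Y \<subseteq> insert x X \<Longrightarrow> agrees g Y (a(x := v))"
  by (auto simp: agrees_def)

lemma agrees_cong: "agrees g X a \<Longrightarrow> (\<And>x. x \<in> X \<Longrightarrow> g x = g' x) \<Longrightarrow> agrees g' X a"
  by (simp add: agrees_def)

text \<open>\<open>X k\<close> is the set of cells known to hold their final value before iteration
  \<open>k\<close>.\<close>

lemma computes_fill:
  assumes "a \<le> e" "agrees g (X a) s" "X e = Y" "(e - a) * Suc d \<le> b"
    and "\<And>k s. a \<le> k \<Longrightarrow> k < e \<Longrightarrow> agrees g (X k) s \<Longrightarrow> computes (f k s) d (agrees g (X (Suc k)))"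
  shows "computes (for_each [a..<e] s f) b (agrees g Y)"
  using computes_for_each[of a e "\<lambda>k. agrees g (X k)", OF assms(1,2,4,5)] assms(3) by simp

lemma msum_Suc: "a \<le> k \<Longrightarrow> msum f {a..<Suc k} = max (msum f {a..<k}) (f k)"
  by (simp add: atLeastLessThanSuc msum_insert)

text \<open>The running maximum starts at 0, which matches the \<open>0\<close> inserted by
  \<open>msum\<close>.\<close>

lemma computes_msum:
  assumes "a \<le> e" "msum f {a..<e} = r" "(e - a) * Suc d \<le> b"
    "\<And>k v. a \<le> k \<Longrightarrow> k < e \<Longrightarrow> computes (g k v) d (\<lambda>w. w = max v (f k))"
  shows "computes (for_each [a..<e] 0 g) b (\<lambda>v. v = r)"
  unfolding assms(2)[symmetric]
  by (rule computes_for_each[where I = "\<lambda>k v. v = msum f {a..<k}", OF assms(1) _ assms(3)])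
    (use assms(4) in \<open>auto simp: msum_Suc\<close>)

section \<open>Results and operation counts of the four steps\<close>

lemma computes_step1:
  assumes "c \<le> n" "\<And>k. k < c \<Longrightarrow> cl k < c" "\<And>i. i < c \<Longrightarrow> hd (N i) < c"
  shows "computes (step1 n c A N cl) ((n - c) * (16 * c + 2)) (\<lambda>r.
    agrees (\<lambda>t. msum (\<lambda>k. A k t) {0..<c}) {c..<n} (fst r) \<and>
    agrees (\<lambda>(t, i). \<exists>k<c. A k t = msum (\<lambda>k. A k t) {0..<c} \<and> cl k = cl (hd (N i)))
      ({c..<n} \<times> {0..<c}) (snd r))"
  unfolding step1_def
proof (rule computes_for_each[where d = "16 * c + 1" and I = "\<lambda>u r.
    agrees (\<lambda>t. msum (\<lambda>k. A k t) {0..<c}) {c..<u} (fst r) \<and>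
    agrees (\<lambda>(t, i). \<exists>k<c. A k t = msum (\<lambda>k. A k t) {0..<c} \<and> cl k = cl (hd (N i)))
      ({c..<u} \<times> {0..<c}) (snd r)", OF assms(1)], goal_cases)
  case (3 t r)
  let ?h = "\<lambda>t. msum (\<lambda>k. A k t) {0..<c}"
  let ?P = "\<lambda>(t, i). \<exists>k<c. A k t = ?h t \<and> cl k = cl (hd (N i))"
  note r = 3
  show ?case
  proof (rule computes_case_prod,
      rule computes_bind[where P = "\<lambda>v. v = ?h t" and d = "3 * c"], goal_cases)
    case 1
    show ?case by (rule computes_msum[OF _ refl, where d = 2]) (auto intro!: computes_intros)
  next
    case (3 h P v)
    note hPv = 3
    show ?case
    proof (rule computes_bind_wr,
        rule computes_bind[where P = "agrees (\<lambda>q. False) {0..<c}" and d = "2 * c"], goal_cases)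
      case 1
      show ?case
        by (rule computes_fill[where X = "\<lambda>q. {0..<q}" and d = 1])
          (auto intro!: computes_intros elim: agrees_upd)
    next
      case (3 F)
      note F0 = 3
      show ?case
      \<comment> \<open>Marking by class label lets each \<open>i\<close> be answered by one lookup,
        which keeps the work linear in \<open>c\<close> for each \<open>t\<close>.\<close>
      proof (rule computes_bind[where P = "agrees (\<lambda>q. \<exists>k<c. A k t = v \<and> cl k = q) {0..<c}"
            and d = "5 * c"], goal_cases)
        case 1
        show ?case
          by (rule computes_for_each[where d = 4 and
                I = "\<lambda>k'. agrees (\<lambda>q. \<exists>k<k'. A k t = v \<and> cl k = q) {0..<c}"])
            (use F0 in \<open>auto intro!: computes_intros simp: agrees_def less_Suc_eq\<close>)
      next
        case (3 F)
        note F = 3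
        show ?case
        proof (rule computes_bind[where P = "agrees ?P ({c..<Suc t} \<times> {0..<c})" and d = "6 * c"], goal_cases)
          case 1
          show ?case
          proof (rule computes_fill[where d = 5 and X = "\<lambda>i. {c..<t} \<times> {0..<c} \<union> {t} \<times> {0..<i}"], goal_cases)
            case (5 i P)
            \<comment> \<open>The bounds on predecessors and labels guarantee that the cell read is
              an initialized one.\<close>
            have "F (cl (hd (N i))) = ?P (t, i)"
              using agreesD[OF F, of "cl (hd (N i))"] assms(2,3) 5 hPv by auto
            with 5(3) show ?case
              by (intro computes_intros agrees_upd[where X = "{c..<t} \<times> {0..<c} \<union> {t} \<times> {0..<i}"]) auto
          qed (use r hPv in auto)
        next
          case (3 P')
          then show ?case
            using hPv r by (auto intro!: computes_return elim!: agrees_upd)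
        qed simp
      qed simp
    qed simp_all
  qed simp
qed auto

text \<open>Each of the \<open>n - c\<close> powers takes a number of operations cubic in
  \<open>n - c\<close>; the resulting fourth power fits the final bound because
  \<open>n - c \<le> n\<close>.\<close>

lemma computes_nc_powers:
  assumes "c \<le> n"
  shows "computes (nc_powers n c A)
    ((n - c) * Suc ((n - c) * Suc ((n - c) * (5 * (n - c) + 5))))
    (agrees (\<lambda>(m, s, t). mpow {c..<n} A m s t) ({0..<n - c} \<times> {c..<n} \<times> {c..<n}))"
  unfolding nc_powers_def
proof (rule computes_fill[where d = "(n - c) * Suc ((n - c) * (5 * (n - c) + 5))"
      and X = "\<lambda>m. {0..<m} \<times> {c..<n} \<times> {c..<n}"], goal_cases)
  let ?S = "{c..<n}"
  case (5 m pw)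
  note m = 5
  show ?case
  proof (rule computes_fill[where d = "(n - c) * (5 * (n - c) + 5)"
        and X = "\<lambda>s. {0..<m} \<times> ?S \<times> ?S \<union> {m} \<times> {c..<s} \<times> ?S"], goal_cases)
    case (5 s pw)
    note s = 5
    show ?case
    proof (rule computes_fill[where d = "5 * (n - c) + 4" and
          X = "\<lambda>t. {0..<m} \<times> ?S \<times> ?S \<union> {m} \<times> {c..<s} \<times> ?S \<union> {m} \<times> {s} \<times> {c..<t}"], goal_cases)
      case (5 t pw)
      note t = 5
      show ?case
      proof (rule computes_bind_op2, rule computes_if, goal_cases)
        case 1
        then show ?case
          by (intro computes_intros agrees_upd[OF t(3)]) auto
      next
        case 2
        then obtain m' where m': "m = Suc m'" by (cases m) auto
        \<comment> \<open>The previous power lies in the blocks below \<open>m\<close>, which are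
          completely written.\<close>
        have pw: "pw (m', s, k) = mpow ?S A m' s k" if "k \<in> ?S" for k
          using agreesD[OF t(3), of "(m', s, k)"] m' s that by auto
        show ?case
        proof (rule computes_bind_op2,
            rule computes_bind[where P = "\<lambda>v. v = mpow ?S A m s t" and d = "5 * (n - c)"], goal_cases)
          case 1
          show ?case
            by (rule computes_msum[where d = 4 and f = "\<lambda>k. mpow ?S A m' s k * A k t"])
              (auto intro!: computes_intros simp: m' mmul_def pw assms)
        next
          case (3 v)
          then show ?case
            by (intro computes_intros agrees_upd[OF t(3)]) auto
        qed simp_all
      qed simp
    qed (use s assms in auto)
  qed (use m assms in auto)
qed auto

text \<open>The maximum must be known before the attaining exponents can be marked, hence two passes
  for each pair. One set of processed pairs governs both arrays in the invariants.\<close>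

lemma computes_step2:
  assumes "c \<le> n"
  shows "computes (step2 n c A)
    ((n - c) * Suc ((n - c) * Suc ((n - c) * (5 * (n - c) + 5))) + (n - c) * Suc ((n - c) * (7 * (n - c) + 2)))
    (\<lambda>r. agrees (\<lambda>(s, t). msum (\<lambda>m. mpow {c..<n} A m s t) {0..<n - c}) ({c..<n} \<times> {c..<n}) (fst r) \<and>
      agrees (\<lambda>(m, s, t). mpow {c..<n} A m s t = msum (\<lambda>m. mpow {c..<n} A m s t) {0..<n - c})
        ({0..<n - c} \<times> {c..<n} \<times> {c..<n}) (snd r))"
  unfolding step2_def
proof (rule computes_bind[OF computes_nc_powers[OF assms]], goal_cases)
  let ?S = "{c..<n}" and ?M = "{0..<n - c}"
  let ?b = "\<lambda>(s, t). msum (\<lambda>m. mpow ?S A m s t) ?M"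
  let ?U = "\<lambda>(m, s, t). mpow ?S A m s t = msum (\<lambda>m. mpow ?S A m s t) ?M"
  let ?I = "\<lambda>X r. agrees ?b X (fst r) \<and> agrees ?U (?M \<times> X) (snd r)"
  case (2 pw)
  note pw = 2
  show ?case unfolding add_diff_cancel_left'
  proof (rule computes_for_each[where d = "(n - c) * (7 * (n - c) + 2)" and
        I = "\<lambda>s. ?I ({c..<s} \<times> ?S)"], goal_cases)
    case (4 s r)
    note s = 4
    have S: "{c..<s} \<times> ?S \<union> {s} \<times> {c..<n} = {c..<Suc s} \<times> ?S" using s by auto
    show ?case unfolding S[symmetric]
    proof (rule computes_for_each[where d = "7 * (n - c) + 1" and
          I = "\<lambda>t. ?I ({c..<s} \<times> ?S \<union> {s} \<times> {c..<t})"], goal_cases)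
      case (4 t r)
      note t = 4
      have pw': "pw (m, s, t) = mpow ?S A m s t" if "m \<in> ?M" for m
        using agreesD[OF pw, of "(m, s, t)"] that s t by auto
      show ?case
      proof (rule computes_case_prod,
          rule computes_bind[where P = "\<lambda>v. v = ?b (s, t)" and d = "3 * (n - c)"], goal_cases)
        case 1
        show ?case
          by (rule computes_msum[where d = 2 and f = "\<lambda>m. mpow ?S A m s t"])
            (auto intro!: computes_intros simp: pw')
      next
        case (3 bs U v)
        note v = 3
        let ?X = "{c..<s} \<times> ?S \<union> {s} \<times> {c..<t}" and ?X' = "{c..<s} \<times> ?S \<union> {s} \<times> {c..<Suc t}"
        have bs: "agrees ?b ?X bs" and U: "agrees ?U (?M \<times> ?X) U" using t v by auto
        have X': "?X' = insert (s, t) ?X" using t by auto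
        show ?case
        proof (rule computes_bind_wr,
            rule computes_bind[where P = "agrees ?U (?M \<times> ?X')" and d = "4 * (n - c)"], goal_cases)
          case 1
          show ?case
          proof (rule computes_fill[where d = 3 and X = "\<lambda>m. ?M \<times> ?X \<union> {0..<m} \<times> {(s, t)}"], goal_cases)
            case (5 m U)
            then show ?case
              using pw'[of m] v(2) by (intro computes_intros agrees_upd[OF 5(3)]) auto
          qed (use U X' in auto)
        next
          case (3 U')
          then show ?case
            using agrees_upd[OF bs, of v "(s, t)" ?X'] v(2) X' by (auto intro!: computes_return)
        qed simp_all
      qed simp
    qed (use s assms in auto)
  qed (use assms in auto)
qed simp

text \<open>The result is expressed through the given arrays; their intended values are substituted
  only when the steps are composed.\<close>

lemma computes_h_times_star:
  assumes "c \<le> n"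
  shows "computes (h_times_star n c h bs) ((n - c) * (11 * (n - c) + 2))
    (\<lambda>r. agrees (\<lambda>t. msum (\<lambda>s. h s * bs (s, t)) {c..<n}) {c..<n} (fst r) \<and>
      agrees (\<lambda>(s, t). h s * bs (s, t) = msum (\<lambda>s. h s * bs (s, t)) {c..<n}) ({c..<n} \<times> {c..<n}) (snd r))"
  unfolding h_times_star_def
proof (rule computes_for_each[where d = "11 * (n - c) + 1" and
      I = "\<lambda>u r. agrees (\<lambda>t. msum (\<lambda>s. h s * bs (s, t)) {c..<n}) {c..<u} (fst r) \<and>
      agrees (\<lambda>(s, t). h s * bs (s, t) = msum (\<lambda>s. h s * bs (s, t)) {c..<n}) ({c..<n} \<times> {c..<u}) (snd r)"],
      goal_cases)
  let ?a = "\<lambda>t. msum (\<lambda>s. h s * bs (s, t)) {c..<n}"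
  let ?W = "\<lambda>(s, t). h s * bs (s, t) = msum (\<lambda>s. h s * bs (s, t)) {c..<n}"
  case (4 t r)
  note t = 4
  show ?case
  proof (rule computes_case_prod,
      rule computes_bind[where P = "\<lambda>v. v = ?a t" and d = "5 * (n - c)"], goal_cases)
    case 1
    show ?case
      by (rule computes_msum[where d = 4 and f = "\<lambda>s. h s * bs (s, t)"])
        (use assms in \<open>auto intro!: computes_intros\<close>)
  next
    case (3 \<alpha> W v)
    note v = 3
    show ?case
    proof (rule computes_bind_wr,
        rule computes_bind[where P = "agrees ?W ({c..<n} \<times> {c..<Suc t})" and d = "6 * (n - c)"], goal_cases)
      case 1
      show ?case
      proof (rule computes_fill[where d = 5 and X = "\<lambda>s. {c..<n} \<times> {c..<t} \<union> {c..<s} \<times> {t}"], goal_cases)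
        case (5 s W)
        then show ?case using v(2) by (intro computes_intros agrees_upd[OF 5(3)]) auto
      qed (use t v assms in auto)
    next
      case (3 W)
      then show ?case using t v by (auto intro!: computes_return elim!: agrees_upd)
    qed simp_all
  qed simp
qed (use assms in auto)

text \<open>The intended content of the table \<open>back\<close>. Any listed predecessor would do
  in place of the first, as only the cyclic class of the result matters.\<close>

definition trace_back :: "(nat \<Rightarrow> nat list) \<Rightarrow> nat \<Rightarrow> nat \<Rightarrow> nat" where
  "trace_back N m = (\<lambda>j. hd (N j)) ^^ m"

lemma trace_back_simps [simp]:
  "trace_back N 0 i = i" "trace_back N (Suc m) i = hd (N (trace_back N m i))"
  by (simp_all add: trace_back_def)

lemma computes_back_table:
  "computes (back_table n c N) ((n - c) * (7 * c + 1))
    (agrees (\<lambda>(m, i). trace_back N m i) ({0..<n - c} \<times> {0..<c}))"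
  unfolding back_table_def
proof (rule computes_fill[where d = "7 * c" and X = "\<lambda>m. {0..<m} \<times> {0..<c}"], goal_cases)
  case (5 m bk)
  note m = 5
  show ?case
  proof (rule computes_fill[where d = 6 and X = "\<lambda>i. {0..<m} \<times> {0..<c} \<union> {m} \<times> {0..<i}"], goal_cases)
    case (5 i bk)
    show ?case
    proof (rule computes_bind_op2, rule computes_if, goal_cases)
      case 1
      then show ?case by (intro computes_intros agrees_upd[OF 5(3)]) auto
    next
      case 2
      then obtain m' where m': "m = Suc m'" by (cases m) auto
      have "bk (m', i) = trace_back N m' i"
        using agreesD[OF 5(3), of "(m', i)"] m' 5(2) by auto
      then show ?case
        by (intro computes_intros agrees_upd[OF 5(3)]) (auto simp: m')
    qed simp
  qed (use m in auto)
qed auto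

text \<open>Cells of \<open>G\<close> are overwritten repeatedly while one \<open>t\<close> is
  processed. The intermediate target is therefore the final \<open>g\<close>, altered at the current
  \<open>t\<close> only.\<close>

definition column :: "nat \<Rightarrow> (nat \<Rightarrow> 'a) \<Rightarrow> (nat \<times> nat \<Rightarrow> 'a) \<Rightarrow> nat \<times> nat \<Rightarrow> 'a" where
  "column t q g = (\<lambda>(t', i). if t' = t then q i else g (t', i))"

lemma agrees_column_cong:
  "agrees (column t q g) (Y \<times> {0..<c}) a \<Longrightarrow> (\<And>i. i < c \<Longrightarrow> q i = q' i) \<Longrightarrow>
    agrees (column t q' g) (Y \<times> {0..<c}) a"
  by (auto simp: agrees_def column_def)

lemma agrees_column_upd:
  "agrees (column t q g) (Y \<times> {0..<c}) a \<Longrightarrow>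
    agrees (column t (q(i := v)) g) (Y \<times> {0..<c}) (a((t, i) := v))"
  by (auto simp: agrees_def column_def)

lemma agrees_column_finish:
  "agrees (column t q g) (Y \<times> {0..<c}) a \<Longrightarrow> (\<And>i. i < c \<Longrightarrow> q i = g (t, i)) \<Longrightarrow>
    agrees g (Y \<times> {0..<c}) a"
  by (auto simp: agrees_def column_def split: if_splits)

lemma agrees_columnD:
  "agrees (column t q g) (Y \<times> {0..<c}) a \<Longrightarrow> t \<in> Y \<Longrightarrow> i < c \<Longrightarrow> a (t, i) = q i"
  by (auto simp: agrees_def column_def)

text \<open>The loops over \<open>t\<close>, \<open>s\<close>, \<open>m\<close> and \<open>i\<close>
  dominate with order \<open>(n - c)^3 * c\<close>; tabulating the backward nodes makes each shifted
  entry a constant-time lookup.\<close>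

lemma computes_step3:
  assumes "c \<le> n"
  shows "computes (step3 n c N h P bs U)
    ((n - c) * (11 * (n - c) + 2) + (n - c) * (7 * c + 1)
      + (n - c) * (2 * c + 1 + (n - c) * (2 + (n - c) * (2 + 6 * c))))
    (\<lambda>r. agrees (\<lambda>t. msum (\<lambda>s. h s * bs (s, t)) {c..<n}) {c..<n} (fst r) \<and>
      agrees (\<lambda>(t, i). \<exists>s\<in>{c..<n}. h s * bs (s, t) = msum (\<lambda>s. h s * bs (s, t)) {c..<n} \<and>
          (\<exists>m<n - c. U (m, s, t) \<and> P (s, trace_back N m i)))
        ({c..<n} \<times> {0..<c}) (snd r))"
  unfolding step3_def
proof (rule computes_bind[OF computes_h_times_star[OF assms]], goal_cases)
  let ?a = "\<lambda>t. msum (\<lambda>s. h s * bs (s, t)) {c..<n}"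
  let ?C = "{0..<c}"
  \<comment> \<open>\<open>R\<close> is the contribution of one pair \<open>s\<close>,
    \<open>m\<close>; \<open>Q\<close> collects one node \<open>s\<close>, and \<open>g\<close> is
    the full disjunction.\<close>
  define R where "R s m t i \<longleftrightarrow> U (m, s, t) \<and> P (s, trace_back N m i)" for s m t i
  define Q where "Q s t i \<longleftrightarrow> h s * bs (s, t) = ?a t \<and> (\<exists>m<n - c. R s m t i)" for s t i
  define g where "g = (\<lambda>(t, i). \<exists>s\<in>{c..<n}. Q s t i)"
  case (2 r)
  note r = 2
  show ?case
  proof (rule computes_case_prod, rule computes_bind[OF computes_back_table], goal_cases)
    case (2 \<alpha> W bk)
    note aWb = 2
    have W: "W (s, t) \<longleftrightarrow> h s * bs (s, t) = ?a t" if "s \<in> {c..<n}" "t \<in> {c..<n}" for s t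
      using r aWb that by (auto simp: agrees_def)
    have bk: "bk (m, i) = trace_back N m i" if "m < n - c" "i < c" for m i
      using agreesD[OF aWb(2), of "(m, i)"] that by auto
    show ?case
    proof (rule computes_bind[where P = "agrees g ({c..<n} \<times> ?C)" and
          d = "(n - c) * (2 * c + 1 + (n - c) * (2 + (n - c) * (2 + 6 * c)))"], goal_cases)
      case 1
      show ?case
      proof (rule computes_fill[where X = "\<lambda>t. {c..<t} \<times> ?C" and
            d = "2 * c + (n - c) * (2 + (n - c) * (2 + 6 * c))"], goal_cases)
        case (5 t G)
        note t = 5
        let ?X = "{c..<Suc t} \<times> ?C"
        have tX: "t \<in> {c..<Suc t}" using t by simp
        show ?case
        proof (rule computes_bind[where P = "agrees (column t (\<lambda>i. False) g) ?X" and d = "2 * c"], goal_cases)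
          case 1
          show ?case
          proof (rule computes_fill[where d = 1 and X = "\<lambda>i. {c..<t} \<times> ?C \<union> {t} \<times> {0..<i}"], goal_cases)
            case 2
            show ?case by (rule agrees_cong[where g = g]) (use t in \<open>auto simp: column_def\<close>)
          next
            case (5 i G)
            then show ?case by (intro computes_intros agrees_upd[OF 5(3)]) (auto simp: column_def)
          qed (use t in auto)
        next
          case (3 G)
          note G = 3
          show ?case
          proof (rule computes_mono[where d = "(n - c) * (2 + (n - c) * (2 + 6 * c))" and
                P = "agrees (column t (\<lambda>i. \<exists>s\<in>{c..<n}. Q s t i) g) ?X"], goal_cases)
            case 1
            show ?case
            proof (rule computes_for_each[where d = "1 + (n - c) * (2 + 6 * c)" and
                  I = "\<lambda>s. agrees (column t (\<lambda>i. \<exists>s\<in>{c..<s}. Q s t i) g) ?X"], goal_cases)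
              case (4 s G)
              note s = 4
              \<comment> \<open>The partial disjunction over all nodes before \<open>s\<close> and,
                for \<open>s\<close> itself, the exponents below \<open>m\<close>.\<close>
              define q where "q m i \<longleftrightarrow> (\<exists>s\<in>{c..<s}. Q s t i) \<or> (\<exists>m'<m. R s m' t i)" for m i
              have q0: "(\<exists>s\<in>{c..<s}. Q s t i) = q 0 i" for i by (simp add: q_def)
              have q_Suc: "q (Suc m) i \<longleftrightarrow> q m i \<or> R s m t i" for m i
                by (auto simp: q_def less_Suc_eq)
              have Ws: "W (s, t) \<longleftrightarrow> h s * bs (s, t) = ?a t" using W s t by simp
              \<comment> \<open>A node outside \<open>W\<close> contributes nothing, in accordance
                with the skipped inner loop.\<close>
              have Suc_s: "(\<exists>s\<in>{c..<Suc s}. Q s t i) \<longleftrightarrow> (if W (s, t) then q (n - c) i else q 0 i)" for i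
                using s by (auto simp: q_def Q_def Ws atLeastLessThanSuc)
              have G0: "agrees (column t (q 0) g) ?X G" using s(3) by (simp add: q0)
              show ?case unfolding Suc_s
              proof (rule computes_bind_rd, rule computes_if, goal_cases)
                case 1
                then have "computes (for_each [0..<n - c] G (\<lambda>m G. do {
                   u \<leftarrow> rd U (m, s, t);
                   if u then for_each [0..<c] G (\<lambda>i G. do {
                     j \<leftarrow> rd bk (m, i);
                     p \<leftarrow> rd P (s, j);
                     g \<leftarrow> rd G (t, i);
                     g' \<leftarrow> op2 (\<or>) g p;
                     wr G (t, i) g' })
                   else State_Monad.return G })) (1 + (n - c) * (2 + 6 * c) - 1)
                   (agrees (column t (q (n - c)) g) ?X)"
                proof (intro computes_for_each[where d = "1 + 6 * c" and I = "\<lambda>m. agrees (column t (q m) g) ?X"], goal_cases)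
                  case (4 m G)
                  note m = 4
                  show ?case
                  proof (rule computes_bind_rd, rule computes_if, goal_cases)
                    case 1
                    note Um = 1
                    show ?case
                    \<comment> \<open>The guard \<open>i < c\<close> records where the inner loop
                      ends; it disappears because only cells with \<open>i < c\<close> are
                      compared.\<close>
                    proof (rule computes_mono[where d = "6 * c" and
                          P = "agrees (column t (\<lambda>i. q m i \<or> i < c \<and> R s m t i) g) ?X"], goal_cases)
                      case 1
                      show ?case
                      proof (rule computes_for_each[where d = 5 and
                            I = "\<lambda>i'. agrees (column t (\<lambda>i. q m i \<or> i < i' \<and> R s m t i) g) ?X"], goal_cases)
                        case 2
                        show ?case using m(4) by simp
                      next
                        case (4 i G)
                        have "G (t, i) = q m i" using agrees_columnD[OF 4(3) tX 4(2)] by simp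
                        then have v: "(G (t, i) \<or> P (s, bk (m, i))) \<longleftrightarrow> q m i \<or> R s m t i"
                          using bk[of m i] m(3) 4(2) Um by (simp add: R_def)
                        show ?case
                          by (intro computes_intros agrees_column_cong[OF agrees_column_upd[OF 4(3)]])
                            (auto simp: v less_Suc_eq)
                      qed auto
                    next
                      case (3 G)
                      then show ?case by (rule agrees_column_cong) (simp add: q_Suc)
                    qed simp
                  next
                    case 2
                    then show ?case
                      by (intro computes_return agrees_column_cong[OF m(4)]) (simp add: q_Suc R_def)
                  qed simp
                qed (use G0 in auto)
                with 1 show ?case by simp
              next
                case 2
                then show ?case using G0 by (intro computes_return) simp
              qed simp
            qed (use assms G in auto)
          next
            case (3 G)
            then show ?case by (rule agrees_column_finish) (simp add: g_def)
          qed simp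
        qed simp
      qed (use assms in auto)
    next
      case (3 G)
      then show ?case using r aWb unfolding g_def Q_def R_def by (intro computes_return) simp
    qed simp
  qed simp
qed simp

lemma computes_step4:
  assumes "c \<le> n"
  shows "computes (step4 n c G) ((n - c) * (5 * c + 1))
    (\<lambda>K. \<forall>i<c. set (K i) = {t \<in> {c..<n}. G (t, i)})"
  unfolding step4_def
proof (rule computes_for_each[where d = "5 * c" and
      I = "\<lambda>u K. \<forall>i<c. set (K i) = {t \<in> {c..<u}. G (t, i)}"], goal_cases)
  case (4 t K)
  note t = 4
  \<comment> \<open>During the inner loop only the lists below the current index have been updated
    for \<open>t\<close>, hence the conditional upper bound.\<close>
  have "computes (for_each [0..<c] K (\<lambda>i K. do {
       g \<leftarrow> rd G (t, i);
       if g then do { ks \<leftarrow> rd K i; ks' \<leftarrow> op2 (#) t ks; wr K i ks' }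
       else State_Monad.return K })) (5 * c)
     (\<lambda>K. \<forall>i<c. set (K i) = {t' \<in> {c..<if i < c then Suc t else t}. G (t', i)})"
    by (rule computes_for_each[where d = 4 and
          I = "\<lambda>i' K. \<forall>i<c. set (K i) = {t' \<in> {c..<if i < i' then Suc t else t}. G (t', i)}"])
      (use t in \<open>auto intro!: computes_intros simp: less_Suc_eq\<close>)
  then show ?case by (rule computes_mono) auto
qed (use assms in auto)

definition algorithm1_cost :: "nat \<Rightarrow> nat \<Rightarrow> nat" where
  "algorithm1_cost b c = b * (16 * c + 2)
     + (b * Suc (b * Suc (b * (5 * b + 5))) + b * Suc (b * (7 * b + 2)))
     + (b * (11 * b + 2) + b * (7 * c + 1) + b * (2 * c + 1 + b * (2 + b * (2 + 6 * c))))
     + b * (5 * c + 1)"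

text \<open>For \<open>b = 0\<close> every summand vanishes. Otherwise
  \<open>1 \<le> b \<le> n\<close> and \<open>c \<le> n\<close> bound each monomial by
  \<open>b ^ 3 * n\<close>, and the coefficients sum to 80.\<close>

lemma algorithm1_cost_le:
  assumes "b \<le> n" "c \<le> n"
  shows "algorithm1_cost b c \<le> 100 * (b ^ 3 * n)"
proof (cases "b = 0")
  case False
  then have b: "1 \<le> b" and n: "1 \<le> n" using assms by auto
  define X where "X = b * b * b * n"
  have le: "x * y * z * w \<le> X" if "x \<le> b" "y \<le> b" "z \<le> b" "w \<le> n" for x y z w
    unfolding X_def using that by (intro mult_le_mono)
  \<comment> \<open>Factors 1 pad every monomial to four factors, so that \<open>le\<close> applies
    uniformly.\<close>
  have "b * b * b * b \<le> X" "b * b * b * 1 \<le> X" "b * b * 1 * 1 \<le> X" "b * 1 * 1 * 1 \<le> X"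
    "b * b * b * c \<le> X" "b * 1 * 1 * c \<le> X"
    by (rule le; use b n assms in simp)+
  moreover have "algorithm1_cost b c = 9 * (b * 1 * 1 * 1) + 16 * (b * b * 1 * 1)
      + 14 * (b * b * b * 1) + 5 * (b * b * b * b) + 30 * (b * 1 * 1 * c) + 6 * (b * b * b * c)"
    unfolding algorithm1_cost_def by (simp add: algebra_simps)
  ultimately have "algorithm1_cost b c \<le> 100 * X" by linarith
  then show ?thesis by (simp add: X_def power3_eq_cube)
qed (simp add: algorithm1_cost_def)

section \<open>Composition of the steps\<close>

context visualized_matrix
begin

text \<open>Here the computed arrays are identified with \<open>h\<close>, \<open>bstar\<close> and
  \<open>\<alpha>\<close>, and equality of class labels is translated into residues of critical
  walks.\<close>

lemma computes_algorithm1: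
  assumes N: "represents_critical_graph \<C> N" and cl: "represents_cyclic_classes \<C> cl"
  shows "computes (algorithm1 n c A N cl) (algorithm1_cost (n - c) c)
    (\<lambda>(a, K). (\<forall>t\<in>{c..<n}. a t = \<alpha> t) \<and> (\<forall>i<c. set (K i) = {t \<in> {c..<n}. selected i t}))"
proof -
  have hd_arc: "(hd (N i), i) \<in> parcs \<C>" if i: "i < c" for i
  proof -
    obtain j where "(j, i) \<in> parcs \<C>" using critical_arc_into[OF i] .
    moreover have "set (N i) = {j. (j, i) \<in> parcs \<C>}"
      using N i pverts_critical by (auto simp: represents_critical_graph_def)
    ultimately show ?thesis by (metis empty_iff hd_in_set list.set(1) mem_Collect_eq)
  qed
  have hd_less: "hd (N i) < c" if "i < c" for i using critical_arc(1)[OF hd_arc[OF that]] .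
  have cl_less: "cl k < c" if "k < c" for k
    using cl that pverts_critical by (simp add: represents_cyclic_classes_def)
  have cl_eq: "cl k = cl j \<longleftrightarrow> cyclic_class \<C> k = cyclic_class \<C> j" if "k < c" "j < c" for k j
    using cl that pverts_critical by (simp add: represents_cyclic_classes_def)
  have trace_less: "trace_back N m i < c" if "i < c" for m i
    by (induction m) (use that hd_less in auto)
  have trace: "path_mod \<C> m (trace_back N m i) i" if i: "i < c" for m i
  proof (induction m)
    case 0
    show ?case using C.path_mod_awalk[of i "[]" i] i pverts_critical by (simp add: C.awalk_Nil_iff)
  next
    case (Suc m)
    let ?j = "trace_back N m i"
    have arc: "(hd (N ?j), ?j) \<in> parcs \<C>" by (rule hd_arc[OF trace_less[OF i]])
    have "path_mod \<C> 1 (hd (N ?j)) ?j"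
      using C.path_mod_awalk[of "hd (N ?j)" "[(hd (N ?j), ?j)]" ?j] arc C.wellformed'[OF arc]
      by (simp add: C.awalk_Cons_iff C.awalk_Nil_iff)
    from C.path_mod_trans[OF this Suc] show ?case by simp
  qed
  \<comment> \<open>The initial vectors already look one edge back, so a shift by \<open>m\<close>
    yields residue \<open>Suc m\<close>.\<close>
  have class_iff: "cl k = cl (hd (N (trace_back N m i))) \<longleftrightarrow> path_mod \<C> (Suc m) k i"
    if "k < c" "i < c" for k m i
    using C.path_mod_same_class[OF strongly_connected_critical trace[of i "Suc m"], of k]
      cl_eq[of k "trace_back N (Suc m) i"] trace_less[of i "Suc m"] that pverts_critical
    by auto
  show ?thesis unfolding algorithm1_def algorithm1_cost_def
  proof (rule computes_bind[OF computes_step1[OF c_le_n cl_less hd_less]], goal_cases)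
    case (4 r)
    show ?case
    proof (rule computes_case_prod, rule computes_bind[OF computes_step2[OF c_le_n]], goal_cases)
      case (2 hv P r2)
      have hv: "hv s = h s" if "s \<in> {c..<n}" for s
        using that 4 2 by (auto simp: agrees_def h_def lessThan_atLeast0)
      have P: "P (s, i) \<longleftrightarrow> (\<exists>k<c. A k s = h s \<and> cl k = cl (hd (N i)))"
        if "s \<in> {c..<n}" "i < c" for s i
        using that 4 2 by (auto simp: agrees_def h_def lessThan_atLeast0)
      note r2 = 2
      show ?case
      proof (rule computes_case_prod, rule computes_bind[OF computes_step3[OF c_le_n]], goal_cases)
        case (2 bs U r3)
        have bs: "bs (s, t) = bstar s t" if "s \<in> {c..<n}" "t \<in> {c..<n}" for s t
          using that r2 2 by (auto simp: agrees_def bstar_def lessThan_atLeast0)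
        have U: "U (m, s, t) \<longleftrightarrow> mpow {c..<n} A m s t = bstar s t"
          if "m < n - c" "s \<in> {c..<n}" "t \<in> {c..<n}" for m s t
          using that r2 2 by (auto simp: agrees_def bstar_def lessThan_atLeast0)
        have alpha: "msum (\<lambda>s. hv s * bs (s, t)) {c..<n} = \<alpha> t" if "t \<in> {c..<n}" for t
          unfolding \<alpha>_def using hv bs that by (intro msum_cong) simp
        note r3 = 2
        show ?case
        proof (rule computes_case_prod, rule computes_bind[OF computes_step4[OF c_le_n]], goal_cases)
          case (2 av G K)
          have "av t = \<alpha> t" if "t \<in> {c..<n}" for t
            using that r3 2 alpha[OF that] by (auto simp: agrees_def)
          moreover have "G (t, i) \<longleftrightarrow> selected i t" if t: "t \<in> {c..<n}" and i: "i < c" for t i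
          proof -
            have "G (t, i) \<longleftrightarrow> (\<exists>s\<in>{c..<n}. hv s * bs (s, t) = msum (\<lambda>s. hv s * bs (s, t)) {c..<n} \<and>
                (\<exists>m<n - c. U (m, s, t) \<and> P (s, trace_back N m i)))"
              using t i r3 2 by (auto simp: agrees_def)
            also have "\<dots> \<longleftrightarrow> selected i t"
              unfolding selected_def
              using hv bs U P alpha t i trace_less[OF i] class_iff
              by (intro bex_cong ex_cong1 conj_cong refl) auto
            finally show ?thesis .
          qed
          ultimately show ?case using 2(2) by (auto intro!: computes_return)
        qed simp
      qed simp
    qed simp
  qed (auto simp: algebra_simps)
qed

end

theorem proposition6p9:
  shows "\<exists>C :: nat. \<forall>(n :: nat) (c :: nat) (A :: nat \<Rightarrow> nat \<Rightarrow> real) (N :: nat \<Rightarrow> nat list) (cl :: nat \<Rightarrow> nat).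
    nonneg_matrix n A \<and> irreducible_matrix n A \<and> visualized n A \<and>
    strongly_connected (with_proj (critical_graph n A)) \<and>
    pverts (critical_graph n A) = {..<c} \<and>
    represents_critical_graph (critical_graph n A) N \<and>
    represents_cyclic_classes (critical_graph n A) cl \<longrightarrow>
    (\<exists>\<alpha> K ops. run_state (algorithm1 n c A N cl) 0 = ((\<alpha>, K), ops) \<and>
       (\<forall>t \<in> {c..<n}. \<alpha> t = core_star n c A Mu (Nu t)) \<and>
       (\<forall>T r. is_transient n A T \<and> T \<le> r \<and> cyclicity (critical_graph n A) dvd r \<longrightarrow>
          (\<forall>i<c. set (K i) = K_set n c A r i) \<and>
          (\<forall>x. (\<forall>i<n. 0 \<le> x i) \<longrightarrow>
             (attraction_system (critical_graph n A) \<alpha> (\<lambda>i. set (K i)) x \<longleftrightarrow>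
              attraction_system (critical_graph n A) (\<lambda>t. core_star n c A Mu (Nu t)) (K_set n c A r) x))) \<and>
       ops \<le> C * ((n - c) ^ 3 * n))"
proof (intro exI[of _ 100] allI impI, elim conjE)
  fix n c A N cl
  assume "nonneg_matrix n A" "visualized n A" "strongly_connected (with_proj (critical_graph n A))"
    "pverts (critical_graph n A) = {..<c}"
  then interpret visualized_matrix n c A by unfold_locales
  assume "represents_critical_graph \<C> N" "represents_cyclic_classes \<C> cl"
  note alg = computes_algorithm1[OF this]
  obtain v ops where v: "run_state (algorithm1 n c A N cl) 0 = (v, ops)"
    "ops \<le> 0 + algorithm1_cost (n - c) c"
    "case v of (a, K) \<Rightarrow> (\<forall>t\<in>{c..<n}. a t = \<alpha> t) \<and> (\<forall>i<c. set (K i) = {t \<in> {c..<n}. selected i t})"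
    using alg[unfolded computes_def] by meson
  obtain a K where aK: "v = (a, K)" by (cases v)
  note run = v(1)[unfolded aK]
  have a: "\<forall>t\<in>{c..<n}. a t = \<alpha> t" and K: "\<forall>i<c. set (K i) = {t \<in> {c..<n}. selected i t}"
    using v(3) aK by auto
  have star: "\<forall>t\<in>{c..<n}. a t = core_star n c A Mu (Nu t)"
    using a core_star_eq_alpha by simp
  have K_set: "\<forall>i<c. set (K i) = K_set n c A r i"
    if "is_transient n A T" "T \<le> r" "cyclicity \<C> dvd r" for T r
    using K K_set_eq[OF that] by simp
  \<comment> \<open>The system involves only critical \<open>i\<close> and indices \<open>t\<close>
    in the sets \<open>K_set\<close>, where the computed data agree with the required ones.\<close>
  have system: "attraction_system \<C> a (\<lambda>i. set (K i)) x \<longleftrightarrow>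
      attraction_system \<C> (\<lambda>t. core_star n c A Mu (Nu t)) (K_set n c A r) x"
    if "is_transient n A T" "T \<le> r" "cyclicity \<C> dvd r" for T r x
  proof -
    have "msum (\<lambda>t. a t * x t) (set (K i)) =
        msum (\<lambda>t. core_star n c A Mu (Nu t) * x t) (K_set n c A r i)" if "i < c" for i
    proof -
      have "set (K i) = K_set n c A r i" using K_set[OF \<open>is_transient n A T\<close> \<open>T \<le> r\<close> \<open>cyclicity \<C> dvd r\<close>] that by blast
      then show ?thesis using star by (auto simp: K_set_def intro!: msum_cong)
    qed
    then show ?thesis unfolding attraction_system_def pverts_critical by simp
  qed
  have "ops \<le> 100 * ((n - c) ^ 3 * n)"
    using v(2) algorithm1_cost_le[of "n - c" n c] c_le_n by simp
  then show "\<exists>\<alpha> K ops. run_state (algorithm1 n c A N cl) 0 = ((\<alpha>, K), ops) \<and>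
       (\<forall>t \<in> {c..<n}. \<alpha> t = core_star n c A Mu (Nu t)) \<and>
       (\<forall>T r. is_transient n A T \<and> T \<le> r \<and> cyclicity \<C> dvd r \<longrightarrow>
          (\<forall>i<c. set (K i) = K_set n c A r i) \<and>
          (\<forall>x. (\<forall>i<n. 0 \<le> x i) \<longrightarrow>
             (attraction_system \<C> \<alpha> (\<lambda>i. set (K i)) x \<longleftrightarrow>
              attraction_system \<C> (\<lambda>t. core_star n c A Mu (Nu t)) (K_set n c A r) x))) \<and>
       ops \<le> 100 * ((n - c) ^ 3 * n)"
  proof (intro exI[of _ a] exI[of _ K] exI[of _ ops] conjI allI impI, goal_cases)
    case 1
    show ?case by (rule run)
  next
    case 2
    show ?case by (rule star)
  next
    case (3 T r i)
    then show ?case using K_set[of T r] by simp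
  next
    case (4 T r x)
    then show ?case using system[of T r x] by simp
  qed
qed

end
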